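(* Let $\lambda\in P$, $\lhd\in\mathrm{RO}(\lambda,\Delta^+)$ and $w\in W$. The forgetful map $\tilde\Xi:\mathcal{A}(w,\Gamma)\to\mathrm{IQLS}(\lambda)\times W$, $A\mapsto(\Xi(A),\mathrm{end}(A))$, is injective.
   Context: Let $\mathfrak{g}$ be a finite-dimensional complex simple Lie algebra with root system $\Delta$, positive roots $\Delta^+$, Weyl group $W$ with length function $\ell$ and reflections $s_\alpha$, weight lattice $P$, pairing $\langle\cdot,\cdot\rangle$, $\alpha^\vee$ the coroot of $\alpha$, $\rho=\frac12\sum_{\alpha\in\Delta^+}\alpha$. For $\alpha\in\Delta$, $\operatorname{sgn}(\alpha)=\pm1$ according as $\alpha\in\pm\Delta^+$, and $|\alpha|=\operatorname{sgn}(\alpha)\alpha$. For $\lambda\in P$, $\Delta^+(\lambda)_{>0}$, $\Delta^+(\lambda)_{=0}$, $\Delta^+(\lambda)_{<0}$ are the sets of $\alpha\in\Delta^+$ with $\langle\lambda,\alpha^\vee\rangle>0$, $=0$, $<0$. Quantum Bruhat graph $\mathrm{QBG}(W)$: vertices $W$; an edge $x\xrightarrow{\alpha}y$ ($\alpha\in\Delta^+$) whenever $y=xs_\alpha$ and either $\ell(y)=\ell(x)+1$ (Bruhat edge) or $\ell(y)=\ell(x)-2\langle\rho,\alpha^\vee\rangle+1$ (quantum edge). Reflection orders: a total order $\lhd$ on $\Delta^+$ is a reflection order if whenever $\alpha,\beta,\alpha+\beta\in\Delta^+$, either $\alpha\lhd\alpha+\beta\lhd\beta$ or $\beta\lhd\alpha+\beta\lhd\alpha$;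 $\mathrm{RO}(\lambda,\Delta^+)$ is the set of those with $\alpha\lhd\beta\lhd\gamma$ for $\alpha\in\Delta^+(\lambda)_{<0}$, $\beta\in\Delta^+(\lambda)_{=0}$, $\gamma\in\Delta^+(\lambda)_{>0}$. Fix such $\lhd$. Interpolated QLS paths: for $x,y\in W$, $\sigma\in\mathbb{Q}$, write $x\overset{(\lambda,+)}{\Longrightarrow}_\sigma y$ if there is a directed path $x=x_0\xrightarrow{\gamma_1}x_1\to\cdots\xrightarrow{\gamma_r}x_r=y$ in $\mathrm{QBG}(W)$ ($r\ge0$) with all $\gamma_k\in\Delta^+(\lambda)_{>0}$, $\gamma_{k+1}\lhd\gamma_k$ for all $k$, and $\sigma\langle\lambda,\gamma_k^\vee\rangle\in\mathbb{Z}$ for all $k$; $x\overset{(\lambda,-)}{\Longrightarrow}_\sigma y$ is defined identically with $\Delta^+(\lambda)_{<0}$ in place of $\Delta^+(\lambda)_{>0}$. An interpolated QLS path of shape $\lambda$ is a triple $\eta=(x_1,\dots,x_s;y_1,\dots,y_{s-1};\sigma_0,\dots,\sigma_s)$ ($s\ge1$) with $x_i,y_i\in W$, $x_i\ne x_{i+1}$, $y_i\ne y_{i+1}$, $\sigma_i\in\mathbb{Q}$, $0=\sigma_0<\sigma_1<\dots<\sigma_s=1$, and for $1\le i\le s-1$: $x_{i+1}\overset{(\lambda,-)}{\Longrightarrow}_{\sigma_i}y_i$ and $y_i\overset{(\lambda,+)}{\Longrightarrow}_{\sigma_i}x_i$. $\mathrm{IQLS}(\lambda)$ is the set of these. Affine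 data: real affine coroots $\gamma^\vee+k\tilde\delta$ ($\gamma\in\Delta$, $k\in\mathbb{Z}$, $\tilde\delta$ formal); for $\beta^\vee=\gamma^\vee+k\tilde\delta$ put $\overline{\beta^\vee}=\gamma^\vee$, $\overline\beta=\gamma$, $\deg(\beta^\vee)=k$; it is positive if $k>0$ or ($k=0$, $\gamma\in\Delta^+$), negative otherwise; $t_\lambda(\gamma^\vee+k\tilde\delta)=\gamma^\vee+(k-\langle\lambda,\gamma^\vee\rangle)\tilde\delta$; $\mathrm{Inv}(\lambda)$ is the set of positive real affine coroots $\beta^\vee$ with $t_\lambda(\beta^\vee)$ negative (for these, $\langle\lambda,\overline{\beta^\vee}\rangle>0$ and $\overline\beta\in\Delta^+(\lambda)_{>0}\sqcup(-\Delta^+(\lambda)_{<0})$); put $d(\beta^\vee)=\deg(\beta^\vee)/\langle\lambda,\overline{\beta^\vee}\rangle$. Order $\prec$ on $\Delta^+(\lambda)_{>0}\sqcup(-\Delta^+(\lambda)_{<0})$: elements of $\Delta^+(\lambda)_{>0}$ precede those of $-\Delta^+(\lambda)_{<0}$; $\gamma\prec\gamma'$ iff $\gamma\lhd\gamma'$ on $\Delta^+(\lambda)_{>0}$; $-\alpha\prec-\alpha'$ iff $\alpha\lhd\alpha'$ on $-\Delta^+(\lambda)_{<0}$. Order $<$ on $\mathrm{Inv}(\lambda)$: $\beta^\vee<\beta'^\vee$ iff $d(\beta^\vee)<d(\beta'^\vee)$, or they are equal and $\overline{\beta'}\prec\overline\beta$. Write $\mathrm{Inv}(\lambda)=\{\beta_1^\vee<\dots<\beta_r^\vee\}$,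 $\gamma_k:=\overline{\beta_k}$, $d_k:=d(\beta_k^\vee)$, and $\Gamma:=(\gamma_1,\dots,\gamma_r)$ (the suitable $\lambda$-chain for $\lhd$). Admissible subsets: for $w\in W$, $\mathcal{A}(w,\Gamma)$ is the set of $A=\{j_1<\dots<j_p\}\subseteq\{1,\dots,r\}$ such that $w=u_0\xrightarrow{|\gamma_{j_1}|}u_1\to\cdots\xrightarrow{|\gamma_{j_p}|}u_p$ is a directed path in $\mathrm{QBG}(W)$, where $u_a:=ws_{|\gamma_{j_1}|}\cdots s_{|\gamma_{j_a}|}$; $\mathrm{end}(A):=u_p$. One has $0\le d_{j_1}\le\dots\le d_{j_p}\le1$. The map $\Xi$: let $0<c_1<\dots<c_{t-1}<1$ ($t\ge1$) be the distinct values among $d_{j_1},\dots,d_{j_p}$ lying strictly between $0$ and $1$; put $c_0:=0$, $c_t:=1$. For $1\le a\le t$ let $m_a:=\#\{b\mid d_{j_b}<c_a\}$; for $1\le a\le t-1$ let $n_a:=m_a+\#\{b\mid m_a<b\le m_{a+1},\ \gamma_{j_b}\in-\Delta^+\}$. Then $\Xi(A):=(x_1,\dots,x_t;y_1,\dots,y_{t-1};\sigma_0,\dots,\sigma_t)$ with $x_i:=u_{m_{t+1-i}}$, $y_i:=u_{n_{t-i}}$, $\sigma_i:=1-c_{t-i}$; this lies in $\mathrm{IQLS}(\lambda)$. *)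

theory Defs
  imports "HOL-Analysis.Analysis"
begin

text \<open>The root system of the simple Lie algebra g, realised in a real Euclidean space 'a.\<close>

definition pair :: "'a::euclidean_space \<Rightarrow> 'a \<Rightarrow> real" where
  "pair lam a = 2 * (lam \<bullet> a) / (a \<bullet> a)"   \<comment> \<open>the pairing of lam with the coroot of a\<close>

definition sref :: "'a::euclidean_space \<Rightarrow> 'a \<Rightarrow> 'a" where
  "sref a = (\<lambda>v. v - pair v a *\<^sub>R a)"

definition root_system :: "'a::euclidean_space set \<Rightarrow> bool" where
  "root_system R \<longleftrightarrow> finite R \<and> 0 \<notin> R \<and> span R = UNIV
     \<and> (\<forall>a\<in>R. \<forall>b\<in>R. sref a b \<in> R \<and> pair b a \<in> \<int>)
     \<and> (\<forall>a\<in>R. \<forall>c::real. c *\<^sub>R a \<in> R \<longrightarrow> c = 1 \<or> c = -1)"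

definition irreducible_rs :: "'a::euclidean_space set \<Rightarrow> bool" where
  "irreducible_rs R \<longleftrightarrow> \<not> (\<exists>R1 R2. R1 \<noteq> {} \<and> R2 \<noteq> {} \<and> R1 \<union> R2 = R \<and> R1 \<inter> R2 = {}
        \<and> (\<forall>a\<in>R1. \<forall>b\<in>R2. a \<bullet> b = 0))"

definition positive_system :: "'a::euclidean_space set \<Rightarrow> 'a set \<Rightarrow> bool" where
  "positive_system R Rp \<longleftrightarrow> (\<exists>v. (\<forall>a\<in>R. a \<bullet> v \<noteq> 0) \<and> Rp = {a\<in>R. a \<bullet> v > 0})"

inductive_set weyl :: "'a::euclidean_space set \<Rightarrow> ('a \<Rightarrow> 'a) set" for R where
  weyl_id: "id \<in> weyl R"
| weyl_step: "x \<in> weyl R \<Longrightarrow> a \<in> R \<Longrightarrow> x \<circ> sref a \<in> weyl R"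

definition simple_roots :: "'a::euclidean_space set \<Rightarrow> 'a set" where
  "simple_roots Rp = {a\<in>Rp. \<not> (\<exists>b\<in>Rp. \<exists>c\<in>Rp. a = b + c)}"

definition wlen :: "'a::euclidean_space set \<Rightarrow> ('a \<Rightarrow> 'a) \<Rightarrow> nat" where
  "wlen Rp x = (LEAST n. \<exists>ss. length ss = n \<and> set ss \<subseteq> simple_roots Rp
                          \<and> x = foldr (\<lambda>a f. sref a \<circ> f) ss id)"

definition rho :: "'a::euclidean_space set \<Rightarrow> 'a" where
  "rho Rp = (1/2) *\<^sub>R (\<Sum>a\<in>Rp. a)"

definition weight_lattice :: "'a::euclidean_space set \<Rightarrow> 'a set" where
  "weight_lattice R = {lam. \<forall>a\<in>R. pair lam a \<in> \<int>}"

definition pos_part :: "'a::euclidean_space set \<Rightarrow> 'a \<Rightarrow> 'a set" where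
  "pos_part Rp lam = {a\<in>Rp. pair lam a > 0}"
definition zero_part :: "'a::euclidean_space set \<Rightarrow> 'a \<Rightarrow> 'a set" where
  "zero_part Rp lam = {a\<in>Rp. pair lam a = 0}"
definition neg_part :: "'a::euclidean_space set \<Rightarrow> 'a \<Rightarrow> 'a set" where
  "neg_part Rp lam = {a\<in>Rp. pair lam a < 0}"

definition qbg_edge :: "'a::euclidean_space set \<Rightarrow> 'a set \<Rightarrow> ('a \<Rightarrow> 'a) \<Rightarrow> 'a \<Rightarrow> ('a \<Rightarrow> 'a) \<Rightarrow> bool" where
  "qbg_edge R Rp x a y \<longleftrightarrow> x \<in> weyl R \<and> y \<in> weyl R \<and> a \<in> Rp \<and> y = x \<circ> sref a \<and>
     (wlen Rp y = wlen Rp x + 1 \<or> real (wlen Rp y) = real (wlen Rp x) - 2 * pair (rho Rp) a + 1)"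

fun qbg_path :: "'a::euclidean_space set \<Rightarrow> 'a set \<Rightarrow> ('a \<Rightarrow> 'a) \<Rightarrow> 'a list \<Rightarrow> ('a \<Rightarrow> 'a) \<Rightarrow> bool" where
  "qbg_path R Rp x [] y \<longleftrightarrow> x \<in> weyl R \<and> y = x"
| "qbg_path R Rp x (a # as) y \<longleftrightarrow> qbg_edge R Rp x a (x \<circ> sref a) \<and> qbg_path R Rp (x \<circ> sref a) as y"

definition reflection_order :: "'a::euclidean_space set \<Rightarrow> ('a \<Rightarrow> 'a \<Rightarrow> bool) \<Rightarrow> bool" where
  "reflection_order Rp lt \<longleftrightarrow>
     (\<forall>a\<in>Rp. \<not> lt a a) \<and> (\<forall>a\<in>Rp. \<forall>b\<in>Rp. \<forall>c\<in>Rp. lt a b \<longrightarrow> lt b c \<longrightarrow> lt a c)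
     \<and> (\<forall>a\<in>Rp. \<forall>b\<in>Rp. a \<noteq> b \<longrightarrow> lt a b \<or> lt b a)
     \<and> (\<forall>a\<in>Rp. \<forall>b\<in>Rp. a + b \<in> Rp \<longrightarrow>
          (lt a (a + b) \<and> lt (a + b) b) \<or> (lt b (a + b) \<and> lt (a + b) a))"

definition RO :: "'a::euclidean_space \<Rightarrow> 'a set \<Rightarrow> ('a \<Rightarrow> 'a \<Rightarrow> bool) \<Rightarrow> bool" where
  "RO lam Rp lt \<longleftrightarrow> reflection_order Rp lt
     \<and> (\<forall>a\<in>neg_part Rp lam. \<forall>b\<in>zero_part Rp lam. lt a b)
     \<and> (\<forall>b\<in>zero_part Rp lam. \<forall>c\<in>pos_part Rp lam. lt b c)
     \<and> (\<forall>a\<in>neg_part Rp lam. \<forall>c\<in>pos_part Rp lam. lt a c)"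

text \<open>Interpolated QLS paths. The relation for the sign + uses S = pos_part, for - uses S = neg_part.\<close>

definition qls_arrow :: "'a::euclidean_space set \<Rightarrow> 'a set \<Rightarrow> 'a \<Rightarrow> ('a \<Rightarrow> 'a \<Rightarrow> bool) \<Rightarrow> 'a set
      \<Rightarrow> real \<Rightarrow> ('a \<Rightarrow> 'a) \<Rightarrow> ('a \<Rightarrow> 'a) \<Rightarrow> bool" where
  "qls_arrow R Rp lam lt S \<sigma> x y \<longleftrightarrow> (\<exists>gs. qbg_path R Rp x gs y
      \<and> (\<forall>g\<in>set gs. g \<in> S \<and> \<sigma> * pair lam g \<in> \<int>)
      \<and> (\<forall>k. Suc k < length gs \<longrightarrow> lt (gs ! Suc k) (gs ! k)))"

text \<open>An element (xs, ys, ss) encodes (x_1..x_s; y_1..y_(s-1); sigma_0..sigma_s) with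
  x_i = xs!(i-1), y_i = ys!(i-1), sigma_i = ss!i.\<close>

definition IQLS :: "'a::euclidean_space set \<Rightarrow> 'a set \<Rightarrow> 'a \<Rightarrow> ('a \<Rightarrow> 'a \<Rightarrow> bool)
      \<Rightarrow> (('a \<Rightarrow> 'a) list \<times> ('a \<Rightarrow> 'a) list \<times> real list) set" where
  "IQLS R Rp lam lt = {(xs, ys, ss). let s = length xs in
      s \<ge> 1 \<and> length ys = s - 1 \<and> length ss = s + 1
      \<and> set xs \<subseteq> weyl R \<and> set ys \<subseteq> weyl R
      \<and> (\<forall>i. Suc i < s \<longrightarrow> xs ! i \<noteq> xs ! Suc i)
      \<and> (\<forall>i. Suc i < s - 1 \<longrightarrow> ys ! i \<noteq> ys ! Suc i)
      \<and> set ss \<subseteq> \<rat> \<and> ss ! 0 = 0 \<and> ss ! s = 1 \<and> (\<forall>i<s. ss ! i < ss ! Suc i)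
      \<and> (\<forall>i\<in>{1..s-1}. qls_arrow R Rp lam lt (neg_part Rp lam) (ss ! i) (xs ! i) (ys ! (i - 1))
                      \<and> qls_arrow R Rp lam lt (pos_part Rp lam) (ss ! i) (ys ! (i - 1)) (xs ! (i - 1)))}"

text \<open>Affine coroots gamma^vee + k delta are encoded as pairs (gamma, k).\<close>

definition Inv :: "'a::euclidean_space set \<Rightarrow> 'a set \<Rightarrow> 'a \<Rightarrow> ('a \<times> int) set" where
  "Inv R Rp lam = {(g, k). g \<in> R \<and> (k > 0 \<or> (k = 0 \<and> g \<in> Rp))
      \<and> \<not> (real_of_int k - pair lam g > 0 \<or> (real_of_int k - pair lam g = 0 \<and> g \<in> Rp))}"

definition dval :: "'a::euclidean_space \<Rightarrow> 'a \<times> int \<Rightarrow> real" where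
  "dval lam b = real_of_int (snd b) / pair lam (fst b)"

definition prec :: "'a::euclidean_space set \<Rightarrow> 'a \<Rightarrow> ('a \<Rightarrow> 'a \<Rightarrow> bool) \<Rightarrow> 'a \<Rightarrow> 'a \<Rightarrow> bool" where
  "prec Rp lam lt g g' \<longleftrightarrow>
     (g \<in> pos_part Rp lam \<and> g' \<in> uminus ` neg_part Rp lam)
   \<or> (g \<in> pos_part Rp lam \<and> g' \<in> pos_part Rp lam \<and> lt g g')
   \<or> (g \<in> uminus ` neg_part Rp lam \<and> g' \<in> uminus ` neg_part Rp lam \<and> lt (- g) (- g'))"

definition inv_less :: "'a::euclidean_space set \<Rightarrow> 'a \<Rightarrow> ('a \<Rightarrow> 'a \<Rightarrow> bool) \<Rightarrow> 'a \<times> int \<Rightarrow> 'a \<times> int \<Rightarrow> bool" where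
  "inv_less Rp lam lt b b' \<longleftrightarrow> dval lam b < dval lam b'
      \<or> (dval lam b = dval lam b' \<and> prec Rp lam lt (fst b') (fst b))"

definition inv_list :: "'a::euclidean_space set \<Rightarrow> 'a set \<Rightarrow> 'a \<Rightarrow> ('a \<Rightarrow> 'a \<Rightarrow> bool) \<Rightarrow> ('a \<times> int) list" where
  "inv_list R Rp lam lt = (THE L. distinct L \<and> set L = Inv R Rp lam \<and> sorted_wrt (inv_less Rp lam lt) L)"

definition gam :: "'a::euclidean_space set \<Rightarrow> 'a set \<Rightarrow> 'a \<Rightarrow> ('a \<Rightarrow> 'a \<Rightarrow> bool) \<Rightarrow> nat \<Rightarrow> 'a" where
  "gam R Rp lam lt j = fst (inv_list R Rp lam lt ! (j - 1))"

definition dd :: "'a::euclidean_space set \<Rightarrow> 'a set \<Rightarrow> 'a \<Rightarrow> ('a \<Rightarrow> 'a \<Rightarrow> bool) \<Rightarrow> nat \<Rightarrow> real" where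
  "dd R Rp lam lt j = dval lam (inv_list R Rp lam lt ! (j - 1))"

definition absr :: "'a::euclidean_space set \<Rightarrow> 'a \<Rightarrow> 'a" where
  "absr Rp g = (if g \<in> Rp then g else - g)"

definition admissible :: "'a::euclidean_space set \<Rightarrow> 'a set \<Rightarrow> 'a \<Rightarrow> ('a \<Rightarrow> 'a \<Rightarrow> bool)
      \<Rightarrow> ('a \<Rightarrow> 'a) \<Rightarrow> nat set set" where
  "admissible R Rp lam lt w = {A. A \<subseteq> {1..length (inv_list R Rp lam lt)} \<and>
      (\<exists>y. qbg_path R Rp w (map (\<lambda>j. absr Rp (gam R Rp lam lt j)) (sorted_list_of_set A)) y)}"

definition uu :: "'a::euclidean_space set \<Rightarrow> 'a set \<Rightarrow> 'a \<Rightarrow> ('a \<Rightarrow> 'a \<Rightarrow> bool)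
      \<Rightarrow> ('a \<Rightarrow> 'a) \<Rightarrow> nat set \<Rightarrow> nat \<Rightarrow> ('a \<Rightarrow> 'a)" where
  "uu R Rp lam lt w A a = foldl (\<lambda>x j. x \<circ> sref (absr Rp (gam R Rp lam lt j))) w
        (take a (sorted_list_of_set A))"

definition adm_end :: "'a::euclidean_space set \<Rightarrow> 'a set \<Rightarrow> 'a \<Rightarrow> ('a \<Rightarrow> 'a \<Rightarrow> bool)
      \<Rightarrow> ('a \<Rightarrow> 'a) \<Rightarrow> nat set \<Rightarrow> ('a \<Rightarrow> 'a)" where
  "adm_end R Rp lam lt w A = uu R Rp lam lt w A (card A)"

definition Xi :: "'a::euclidean_space set \<Rightarrow> 'a set \<Rightarrow> 'a \<Rightarrow> ('a \<Rightarrow> 'a \<Rightarrow> bool)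
      \<Rightarrow> ('a \<Rightarrow> 'a) \<Rightarrow> nat set \<Rightarrow> ('a \<Rightarrow> 'a) list \<times> ('a \<Rightarrow> 'a) list \<times> real list" where
  "Xi R Rp lam lt w A =
    (let js = sorted_list_of_set A; p = length js;
         db = (\<lambda>b. dd R Rp lam lt (js ! (b - 1)));
         cs = sorted_list_of_set {db b | b. b \<in> {1..p} \<and> 0 < db b \<and> db b < 1};
         t = length cs + 1;
         c = (\<lambda>a. if a = 0 then 0 else if a = t then 1 else cs ! (a - 1));
         m = (\<lambda>a. card {b \<in> {1..p}. db b < c a});
         n = (\<lambda>a. m a + card {b. m a < b \<and> b \<le> m (Suc a) \<and> gam R Rp lam lt (js ! (b - 1)) \<in> uminus ` Rp});
         u = uu R Rp lam lt w A
     in (map (\<lambda>i. u (m (t + 1 - i))) [1..<t+1],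
         map (\<lambda>i. u (n (t - i))) [1..<t],
         map (\<lambda>i. 1 - c (t - i)) [0..<t+1]))"

end

theory Submission
  imports Defs
begin

text \<open>
  Between consecutive cut values the path of an admissible subset is traversed with strictly
  decreasing labels, first through the roots of \<open>- \<Delta>\<^sup>+\<close> and then through those of \<open>\<Delta>\<^sup>+\<close>,
  and \<open>\<Xi>\<close> together with the end point records the end points of all these pieces. So everything
  rests on the uniqueness of monotone paths from \<open>x\<close> to \<open>y\<close> in the quantum Bruhat graph.

  For uniqueness, call \<open>x\<close> positive for \<open>\<eta>\<close> (a simple root, or \<open>- \<theta>\<close> with \<open>\<theta>\<close> a highest
  root, i.e. a wall of the fundamental alcove at level zero) if \<open>x\<^bsup>-1\<^esup> \<eta>\<close> is positive. Left
  multiplication by \<open>s\<^sub>\<eta>\<close> preserves edges and their labels as long as the sign does not change, and the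
  only edge from a positive to a negative vertex is the crossing from \<open>x\<close> to \<open>s\<^sub>\<eta> x\<close>, which always
  exists. Deleting the first crossing, or inserting one at the only place where monotonicity
  allows it, injects the monotone paths from a positive \<open>x\<close> to \<open>y\<close> into those from \<open>s\<^sub>\<eta> x\<close> to \<open>y\<close> or
  to \<open>s\<^sub>\<eta> y\<close>. Positive crossings lead from every vertex to the identity, and insertions lead from
  there to the pair of the identity and the longest element, for which all positive roots
  must occur as labels.
\<close>

section \<open>Root systems\<close>


text \<open>Left multiplication by a reflection moves a whole path and keeps its labels, hence its
  monotonicity; only the label of a crossing is delicate. It is \<open>inv x e\<close>, and each
  step along \<open>b\<close> replaces it by its image under \<open>sref b\<close>. The axiom of a
  reflection order ensures that this image does not slip past \<open>b\<close> in the wrong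
  direction, and this is what fixes the place of an inserted crossing. Simple walls alone would not
  do: their positive crossings always lengthen \<open>x\<close> and would end in the longest
  element. The walls \<open>- t\<close> with \<open>t\<close> a maximal root, crossed by quantum
  edges, close this flow into cycles, so that every vertex leads back to the identity. There all
  simple walls are positive at once, so the end of a path can be raised step by step while its start
  stays put, until counting lengths determines the path.\<close>

lemma pair_add: "pair (x + y) a = pair x a + pair y a"
  by (simp add: pair_def inner_add_left add_divide_distrib distrib_left)

lemma pair_scale: "pair (c *\<^sub>R x) a = c * pair x a"
  by (simp add: pair_def)

lemma pair_minus: "pair (- x) a = - pair x a"
  by (simp add: pair_def)

lemma pair_minus_right: "pair x (- a) = - pair x a"
  by (simp add: pair_def)

lemma pair_diff: "pair (x - y) a = pair x a - pair y a"
  by (simp add: pair_def inner_diff_left diff_divide_distrib right_diff_distrib)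

lemma pair_sum: "pair (sum f A) a = (\<Sum>i\<in>A. pair (f i) a)"
  by (simp add: pair_def inner_sum_left sum_distrib_left sum_divide_distrib)

lemma pair_self: "a \<noteq> 0 \<Longrightarrow> pair a a = 2"
  by (simp add: pair_def)

lemma pair_pos_iff: "a \<noteq> 0 \<Longrightarrow> pair x a > 0 \<longleftrightarrow> x \<bullet> a > 0"
  by (simp add: pair_def zero_less_divide_iff) (metis inner_ge_zero not_less)

lemma sref_self: "a \<noteq> 0 \<Longrightarrow> sref a a = - a"
  by (simp add: sref_def pair_self scaleR_2)

lemma sref_minus_arg: "sref a (- x) = - sref a x"
  by (simp add: sref_def pair_minus)

lemma sref_minus_root: "sref (- a) = sref a"
  by (simp add: sref_def pair_minus_right)

lemma pair_sref: "a \<noteq> 0 \<Longrightarrow> pair (sref a x) a = - pair x a"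
  by (simp add: sref_def pair_diff pair_scale pair_self)

lemma sref_sref: "a \<noteq> 0 \<Longrightarrow> sref a (sref a x) = x"
  using pair_sref[of a x] by (simp add: sref_def)

lemma linear_sref: "linear (sref a)"
  by (rule linearI) (simp_all add: sref_def pair_add pair_scale algebra_simps)

lemma orthogonal_sref: "orthogonal_transformation (sref a)"
proof (cases "a = 0")
  case True
  then have "sref a = id" by (simp add: sref_def fun_eq_iff)
  then show ?thesis by (simp add: orthogonal_transformation_def linear_id id_def)
next
  case False
  have "sref a x \<bullet> sref a y = x \<bullet> y" for x y
    using False by (simp add: sref_def pair_def inner_diff_left inner_diff_right field_simps inner_commute)
  then show ?thesis by (simp add: orthogonal_transformation_def linear_sref)
qed

lemma pair_orthogonal: "orthogonal_transformation x \<Longrightarrow> pair (x a) (x b) = pair a b"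
  by (simp add: pair_def orthogonal_transformation_def)

lemma sref_conj:
  assumes "orthogonal_transformation x"
  shows "x (sref a z) = sref (x a) (x z)"
  using assms by (simp add: sref_def pair_orthogonal linear_diff linear_scale orthogonal_transformation_linear)

lemma orthogonal_weyl: "x \<in> weyl R \<Longrightarrow> orthogonal_transformation x"
proof (induction rule: weyl.induct)
  case weyl_id
  then show ?case by (simp add: orthogonal_transformation_def linear_id id_def)
next
  case (weyl_step x a)
  then show ?case by (blast intro: orthogonal_sref orthogonal_transformation_compose)
qed

lemma linear_weyl: "x \<in> weyl R \<Longrightarrow> linear x"
  by (simp add: orthogonal_weyl orthogonal_transformation_linear)

lemma bij_weyl: "x \<in> weyl R \<Longrightarrow> bij x"
  by (simp add: orthogonal_weyl orthogonal_transformation_bij)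

lemma weyl_inv: "x \<in> weyl R \<Longrightarrow> x (inv x z) = z"
  by (meson bij_inv_eq_iff bij_weyl)

lemma weyl_minus: "x \<in> weyl R \<Longrightarrow> x (- a) = - x a"
  by (simp add: linear_weyl linear_neg)

section \<open>A reduced root system with the positive system of a generic vector\<close>

locale root_sys =
  fixes R Rp :: "'a::euclidean_space set" and v :: 'a
  assumes rs: "root_system R"
    and v_nonzero: "\<And>a. a \<in> R \<Longrightarrow> a \<bullet> v \<noteq> 0"
    and Rp_eq: "Rp = {a\<in>R. a \<bullet> v > 0}"
begin

lemma finR: "finite R" using rs by (simp add: root_system_def)
lemma finRp: "finite Rp" using finR by (simp add: Rp_eq)
lemma root_nz: "a \<in> R \<Longrightarrow> a \<noteq> 0" using rs by (auto simp add: root_system_def)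
lemma sref_root: "a \<in> R \<Longrightarrow> b \<in> R \<Longrightarrow> sref a b \<in> R" using rs by (simp add: root_system_def)
lemma pair_int: "a \<in> R \<Longrightarrow> b \<in> R \<Longrightarrow> pair b a \<in> \<int>" using rs by (simp add: root_system_def)
lemma span_R: "span R = UNIV" using rs by (simp add: root_system_def)
lemma scale_root: "a \<in> R \<Longrightarrow> c *\<^sub>R a \<in> R \<Longrightarrow> c = 1 \<or> c = -1" using rs by (simp add: root_system_def)

lemma Rp_R: "a \<in> Rp \<Longrightarrow> a \<in> R" by (simp add: Rp_eq)
lemma Rp_nz: "a \<in> Rp \<Longrightarrow> a \<noteq> 0" by (simp add: Rp_R root_nz)
lemma Rp_pos: "a \<in> Rp \<Longrightarrow> a \<bullet> v > 0" by (simp add: Rp_eq)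
lemma Rp_iff: "a \<in> R \<Longrightarrow> a \<in> Rp \<longleftrightarrow> a \<bullet> v > 0" by (simp add: Rp_eq)

lemma neg_root: "a \<in> R \<Longrightarrow> - a \<in> R"
  using sref_root[of a a] by (simp add: sref_self root_nz)

lemma neg_root_iff: "- a \<in> R \<longleftrightarrow> a \<in> R"
  using neg_root[of a] neg_root[of "- a"] by auto

lemma neg_Rp: "a \<in> R \<Longrightarrow> - a \<in> Rp \<longleftrightarrow> a \<notin> Rp"
  using v_nonzero[of a] neg_root[of a] by (auto simp add: Rp_eq)

lemma notin_neg: "a \<in> Rp \<Longrightarrow> - a \<notin> Rp"
  using neg_Rp[of a] by (simp add: Rp_R)

text \<open>By strict Cauchy-Schwarz the product of the two positive integers is below 4, so one of
  them is 1. Equality would make \<open>a\<close> a positive multiple of \<open>b\<close>, hence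
  \<open>b\<close> itself, as the system is reduced.\<close>

lemma pair_bound:
  assumes "a \<in> R" "b \<in> R" "a \<noteq> b" "a \<bullet> b > 0"
  shows "(pair a b = 1 \<and> pair b a \<in> {1,2,3}) \<or> (pair b a = 1 \<and> pair a b \<in> {1,2,3})"
proof -
  obtain m n :: int where m: "pair a b = of_int m" and n: "pair b a = of_int n"
    using assms pair_int by (metis Ints_cases)
  have mp: "m > 0" "n > 0"
    using assms pair_pos_iff[of b a] pair_pos_iff[of a b] root_nz m n by (auto simp: inner_commute)
  have ap: "a \<bullet> a > 0" "b \<bullet> b > 0" using assms root_nz by auto
  have strict: "(a \<bullet> b)\<^sup>2 < (a \<bullet> a) * (b \<bullet> b)"
  proof (rule ccontr)
    assume "\<not> ?thesis"
    then have "(a \<bullet> b)\<^sup>2 = (a \<bullet> a) * (b \<bullet> b)" using Cauchy_Schwarz_ineq[of a b] by linarith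
    then have "(norm (a \<bullet> b))\<^sup>2 = (norm a * norm b)\<^sup>2"
      by (simp add: power_mult_distrib power2_norm_eq_inner)
    then have "\<bar>a \<bullet> b\<bar> = norm a * norm b"
      by (metis abs_norm_cancel norm_ge_zero norm_mult power2_eq_iff_nonneg real_norm_def)
    then have "norm a *\<^sub>R b = norm b *\<^sub>R a"
      using assms(4) norm_cauchy_schwarz_eq by (metis abs_of_pos)
    then have "(1 / norm b) *\<^sub>R (norm a *\<^sub>R b) = (1 / norm b) *\<^sub>R (norm b *\<^sub>R a)" by simp
    then have "a = (norm a / norm b) *\<^sub>R b" using ap by simp
    then have "norm a / norm b = 1 \<or> norm a / norm b = -1"
      using scale_root[of b] assms by metis
    moreover have "norm a / norm b > 0" using ap by simp
    ultimately have "a = b" using \<open>a = (norm a / norm b) *\<^sub>R b\<close>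
      by (metis less_numeral_extra(4) not_one_less_zero scaleR_one zero_less_one neg_0_less_iff_less)
    then show False using assms by simp
  qed
  have "real_of_int (m * n) = 4 * (a \<bullet> b)\<^sup>2 / ((a \<bullet> a) * (b \<bullet> b))"
    unfolding of_int_mult m[symmetric] n[symmetric]
    by (simp add: pair_def power2_eq_square inner_commute)
  also have "\<dots> < 4" using strict ap by (simp add: divide_less_eq)
  finally have mn: "m * n < 4" by linarith
  have "m = 1 \<or> n = 1"
  proof (rule ccontr)
    assume "\<not> ?thesis"
    then have "m \<ge> 2" "n \<ge> 2" using mp by auto
    then have "m * n \<ge> 2 * 2" by (intro mult_mono) auto
    then show False using mn by simp
  qed
  moreover have "m = 1 \<Longrightarrow> n \<in> {1,2,3}" "n = 1 \<Longrightarrow> m \<in> {1,2,3}" using mn mp by auto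
  ultimately show ?thesis using m n by auto
qed

lemma root_diff:
  assumes "a \<in> R" "b \<in> R" "a \<noteq> b" "a \<bullet> b > 0"
  shows "a - b \<in> R"
proof -
  from pair_bound[OF assms] consider "pair a b = 1" | "pair b a = 1" by auto
  then show ?thesis
  proof cases
    case 1
    then show ?thesis using sref_root[of b a] assms by (simp add: sref_def)
  next
    case 2
    then have "b - a \<in> R" using sref_root[of a b] assms by (simp add: sref_def)
    then show ?thesis using neg_root by force
  qed
qed

text \<open>Strictly between \<open>a\<close> and its mirror image there are only
  \<open>a - b\<close> and, for \<open>k = 3\<close>, also \<open>a - 2 b\<close>, since
  \<open>k\<close> is at most 3; the latter is the mirror image of \<open>a - b\<close>.\<close>

lemma root_string:
  assumes "a \<in> R" "b \<in> R" "a \<noteq> b" "pair a b = real k" "j \<le> k"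
  shows "a - real j *\<^sub>R b \<in> R"
proof (cases "j = 0 \<or> j = k")
  case True
  then show ?thesis using assms sref_root[of b a] by (auto simp: sref_def)
next
  case False
  then have kp: "k > 0" "0 < j" "j < k" using assms by auto
  have pos: "a \<bullet> b > 0" using assms kp pair_pos_iff[of b a] root_nz by auto
  have 1: "a - b \<in> R" using root_diff assms pos by simp
  have "k \<le> 3" using pair_bound[OF assms(1-3) pos] assms(4) by auto
  then consider "j = 1" | "j = 2" "k = 3" using kp by linarith
  then show ?thesis
  proof cases
    case 1
    then show ?thesis using \<open>a - b \<in> R\<close> by simp
  next
    case 2
    have "pair (a - b) b = 1" using 2 assms by (simp add: pair_diff pair_self root_nz)
    then show ?thesis using sref_root[OF assms(2) 1] 2
      by (simp add: sref_def scaleR_2 algebra_simps)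
  qed
qed

text \<open>The \<open>b\<close>-string from \<open>a\<close> to the negative root
  \<open>sref b a\<close> changes sign between two neighbours. The last positive one and the negated
  first negative one add up to \<open>b\<close>: this is impossible for simple \<open>b\<close>, and
  lets a reflection order compare \<open>b\<close> with both summands.\<close>

lemma split_root:
  assumes "a \<in> Rp" "b \<in> Rp" "a \<noteq> b" "sref b a \<notin> Rp"
  obtains k j where "pair a b = real k" "1 \<le> j" "j \<le> k"
    "a - real (j - 1) *\<^sub>R b \<in> Rp" "real j *\<^sub>R b - a \<in> Rp"
proof -
  note ab = assms(1,2)[THEN Rp_R]
  have "sref b a \<in> R" using sref_root ab by simp
  then have neg: "(a - pair a b *\<^sub>R b) \<bullet> v < 0"
    using assms(4) v_nonzero[of "sref b a"] by (simp add: Rp_iff sref_def)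
  have "pair a b > 0"
  proof (rule ccontr)
    assume "\<not> ?thesis"
    then have "pair a b * (b \<bullet> v) \<le> 0" using Rp_pos[OF assms(2)] by (simp add: mult_nonpos_nonneg)
    then show False using neg Rp_pos[OF assms(1)] by (simp add: inner_diff_left)
  qed
  then obtain k :: nat where k: "pair a b = real k" 
    using pair_int[OF ab(2,1)] by (metis Ints_cases of_int_0_less_iff of_int_of_nat_eq zero_less_imp_eq_int)
  define P where "P j \<longleftrightarrow> (a - real j *\<^sub>R b) \<bullet> v < 0" for j
  define j where "j = (LEAST j. P j)"
  have "P k" using neg k by (simp add: P_def)
  then have Pj: "P j" and jk: "j \<le> k" unfolding j_def by (auto intro: LeastI Least_le)
  have "\<not> P 0" using Rp_pos[OF assms(1)] by (simp add: P_def)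
  then have j1: "1 \<le> j" using Pj by (metis less_one not_le)
  have "\<not> P (j - 1)" using j1 not_less_Least[of "j - 1" P] by (simp add: j_def)
  have r1: "a - real (j - 1) *\<^sub>R b \<in> R" and r2: "a - real j *\<^sub>R b \<in> R"
    using root_string[OF ab assms(3) k] jk by auto
  have "a - real (j - 1) *\<^sub>R b \<in> Rp"
    using r1 \<open>\<not> P (j - 1)\<close> v_nonzero[OF r1] by (simp add: Rp_iff P_def)
  moreover have "- (a - real j *\<^sub>R b) \<in> Rp"
    using r2 Pj neg_Rp[OF r2] by (simp add: Rp_iff P_def)
  ultimately show thesis using that[OF k j1 jk] by simp
qed

lemma simple_Rp: "a \<in> simple_roots Rp \<Longrightarrow> a \<in> Rp"
  by (simp add: simple_roots_def)

lemma simple_sref_pos: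
  assumes "a \<in> simple_roots Rp" "c \<in> Rp" "c \<noteq> a"
  shows "sref a c \<in> Rp"
proof (rule ccontr)
  assume "sref a c \<notin> Rp"
  then obtain k j where *: "1 \<le> j" "c - real (j - 1) *\<^sub>R a \<in> Rp" "real j *\<^sub>R a - c \<in> Rp"
    using split_root[of c a] assms simple_Rp by metis
  then have "a = (c - real (j - 1) *\<^sub>R a) + (real j *\<^sub>R a - c)" by (simp add: of_nat_diff algebra_simps)
  then show False using * assms unfolding simple_roots_def by blast
qed

end

section \<open>Length in the Weyl group\<close>


fun word_prod :: "'a::euclidean_space list \<Rightarrow> 'a \<Rightarrow> 'a" where
  "word_prod [] = id"
| "word_prod (a # ss) = sref a \<circ> word_prod ss"

lemma foldr_word_prod: "foldr (\<lambda>a f. sref a \<circ> f) ss id = word_prod ss"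
  by (induction ss) simp_all

lemma word_prod_append: "word_prod (ss @ ts) = word_prod ss \<circ> word_prod ts"
  by (induction ss) (simp_all add: comp_assoc)

context root_sys
begin

text \<open>The heights \<open>a \<bullet> v\<close> are real numbers, so the induction runs over
  the number of positive roots of smaller height.\<close>

lemma Rp_induct [consumes 1, case_names less]:
  assumes "a \<in> Rp" and step: "\<And>a. a \<in> Rp \<Longrightarrow> (\<And>b. b \<in> Rp \<Longrightarrow> b \<bullet> v < a \<bullet> v \<Longrightarrow> P b) \<Longrightarrow> P a"
  shows "P a"
  using assms(1)
proof (induction a rule: measure_induct_rule[where f = "\<lambda>a. card {c\<in>Rp. c \<bullet> v < a \<bullet> v}"])
  case (less a)
  show ?case
  proof (rule step[OF less.prems])
    fix b assume b: "b \<in> Rp" "b \<bullet> v < a \<bullet> v"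
    then have "{c\<in>Rp. c \<bullet> v < b \<bullet> v} \<subset> {c\<in>Rp. c \<bullet> v < a \<bullet> v}" by auto
    then have "card {c\<in>Rp. c \<bullet> v < b \<bullet> v} < card {c\<in>Rp. c \<bullet> v < a \<bullet> v}"
      by (intro psubset_card_mono) (simp_all add: finRp)
    then show "P b" using less.IH b by blast
  qed
qed

lemma Rp_induct_down [consumes 1, case_names greater]:
  assumes "a \<in> Rp" and step: "\<And>a. a \<in> Rp \<Longrightarrow> (\<And>b. b \<in> Rp \<Longrightarrow> b \<bullet> v > a \<bullet> v \<Longrightarrow> P b) \<Longrightarrow> P a"
  shows "P a"
  using assms(1)
proof (induction a rule: measure_induct_rule[where f = "\<lambda>a. card {c\<in>Rp. c \<bullet> v > a \<bullet> v}"])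
  case (less a)
  show ?case
  proof (rule step[OF less.prems])
    fix b assume b: "b \<in> Rp" "b \<bullet> v > a \<bullet> v"
    then have "{c\<in>Rp. c \<bullet> v > b \<bullet> v} \<subset> {c\<in>Rp. c \<bullet> v > a \<bullet> v}" by auto
    then have "card {c\<in>Rp. c \<bullet> v > b \<bullet> v} < card {c\<in>Rp. c \<bullet> v > a \<bullet> v}"
      by (intro psubset_card_mono) (simp_all add: finRp)
    then show "P b" using less.IH b by blast
  qed
qed

text \<open>Replaces the expansion of a positive root into simple roots: one that is not simple
  splits into two positive roots of smaller height.\<close>

lemma nonneg_on_simple:
  assumes "\<And>a. a \<in> simple_roots Rp \<Longrightarrow> p \<bullet> a \<ge> 0" and "b \<in> Rp"
  shows "p \<bullet> b \<ge> 0"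
  using assms(2)
proof (induction b rule: Rp_induct)
  case (less b)
  show ?case
  proof (cases "b \<in> simple_roots Rp")
    case True
    then show ?thesis using assms(1) by simp
  next
    case False
    then obtain c d where cd: "c \<in> Rp" "d \<in> Rp" "b = c + d"
      using less.hyps by (auto simp: simple_roots_def)
    then have "p \<bullet> c \<ge> 0" "p \<bullet> d \<ge> 0"
      using less.IH Rp_pos[of c] Rp_pos[of d] by (auto simp: inner_add_left)
    then show ?thesis by (simp add: cd inner_add_right)
  qed
qed

lemma simple_R: "a \<in> simple_roots Rp \<Longrightarrow> a \<in> R"
  by (simp add: Rp_R simple_Rp)

lemma weyl_root: "x \<in> weyl R \<Longrightarrow> a \<in> R \<Longrightarrow> x a \<in> R"
proof (induction arbitrary: a rule: weyl.induct)
  case weyl_id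
  then show ?case by simp
next
  case (weyl_step x b)
  then show ?case by (simp add: sref_root)
qed

lemma inv_root:
  assumes "x \<in> weyl R" "a \<in> R"
  shows "inv x a \<in> R"
proof -
  have "inj x" using assms bij_weyl bij_is_inj by blast
  have "x ` R \<subseteq> R" using weyl_root[OF assms(1)] by blast
  then have "x ` R = R"
    using endo_inj_surj[OF finR] inj_on_subset[OF \<open>inj x\<close> subset_UNIV] by blast
  then have "a \<in> x ` R" using assms(2) by simp
  then obtain b where "a = x b" "b \<in> R" by (rule imageE)
  then show ?thesis using inv_f_f[OF \<open>inj x\<close>] by simp
qed

lemma inv_weyl: "x \<in> weyl R \<Longrightarrow> inv x (x z) = z"
  using bij_weyl bij_is_inj inv_f_f by metis

lemma inv_weyl_minus:
  assumes "x \<in> weyl R"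
  shows "inv x (- z) = - inv x z"
  using inv_weyl[OF assms, of "- inv x z"]
  unfolding weyl_minus[OF assms, of "inv x z"] weyl_inv[OF assms, of z] .

lemma left_eq_right:
  assumes "x \<in> weyl R"
  shows "sref a \<circ> x = x \<circ> sref (inv x a)"
proof
  fix z
  show "(sref a \<circ> x) z = (x \<circ> sref (inv x a)) z"
    using sref_conj[OF orthogonal_weyl[OF assms], of "inv x a" z] assms by (simp add: weyl_inv)
qed

lemma left_weyl: "x \<in> weyl R \<Longrightarrow> a \<in> R \<Longrightarrow> sref a \<circ> x \<in> weyl R"
  by (simp add: left_eq_right weyl.weyl_step inv_root)

lemma left_left:
  assumes "a \<in> R" shows "sref a \<circ> (sref a \<circ> x) = x"
  using assms by (simp add: fun_eq_iff sref_sref root_nz)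

lemma sref_conj_comp:
  assumes "b \<in> R"
  shows "sref b \<circ> sref (sref b a) = sref a \<circ> sref b"
proof
  fix z
  have "sref b (sref (sref b a) z) = sref (sref b (sref b a)) (sref b z)"
    by (rule sref_conj[OF orthogonal_sref])
  then show "(sref b \<circ> sref (sref b a)) z = (sref a \<circ> sref b) z"
    by (simp add: sref_sref[OF root_nz[OF assms]])
qed

lemma inv_left:
  assumes "x \<in> weyl R" "a \<in> R"
  shows "inv (sref a \<circ> x) z = inv x (sref a z)"
proof -
  have "(sref a \<circ> x) (inv x (sref a z)) = z" using assms by (simp add: weyl_inv sref_sref root_nz)
  then show ?thesis using inv_weyl[OF left_weyl[OF assms]] by metis
qed

lemma inv_right:
  assumes "x \<in> weyl R" "a \<in> R"
  shows "inv (x \<circ> sref a) z = sref a (inv x z)"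
proof -
  have "(x \<circ> sref a) (sref a (inv x z)) = z" using assms by (simp add: weyl_inv sref_sref root_nz)
  then show ?thesis using inv_weyl[OF weyl.weyl_step[OF assms]] by metis
qed

text \<open>The inversion number. It equals the word length (\<open>wlen_invs\<close>) and, unlike a
  minimum over words, can be compared along an edge root by root.\<close>

definition invs :: "('a \<Rightarrow> 'a) \<Rightarrow> nat" where
  "invs x = card {a\<in>Rp. x a \<notin> Rp}"

text \<open>Apart from \<open>a\<close>, \<open>sref a\<close> permutes the positive roots, so only
  images \<open>x c\<close> equal to \<open>a\<close> or \<open>- a\<close> change sign;
  \<open>- a\<close> cannot occur for positive \<open>c\<close>, because \<open>inv x a\<close> is
  positive.\<close>

lemma invs_left_up:
  assumes "a \<in> simple_roots Rp" "x \<in> weyl R" "inv x a \<in> Rp"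
  shows "invs (sref a \<circ> x) = invs x + 1"
proof -
  have "{c\<in>Rp. (sref a \<circ> x) c \<notin> Rp} = insert (inv x a) {c\<in>Rp. x c \<notin> Rp}"
  proof (intro set_eqI)
    fix c
    show "c \<in> {c\<in>Rp. (sref a \<circ> x) c \<notin> Rp} \<longleftrightarrow> c \<in> insert (inv x a) {c\<in>Rp. x c \<notin> Rp}"
    proof (cases "c \<in> Rp")
      case c: True
      consider "x c = a" | "x c \<noteq> a" "x c \<in> Rp" | "x c \<noteq> a" "x c \<notin> Rp" by blast
      then show ?thesis
      proof cases
        case 1
        then have "c = inv x a" using inv_weyl[OF assms(2)] by metis
        moreover have "sref a a \<notin> Rp" using assms simple_Rp Rp_nz notin_neg by (simp add: sref_self)
        ultimately show ?thesis using 1 c by simp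
      next
        case 2
        then have "c \<noteq> inv x a" using weyl_inv[OF assms(2)] by metis
        then show ?thesis using 2 simple_sref_pos[OF assms(1), of "x c"] by simp
      next
        case 3
        have xc: "- x c \<in> Rp" using 3 c assms neg_Rp weyl_root Rp_R by blast
        have "- x c \<noteq> a"
        proof
          assume "- x c = a"
          then have "inv x a = - c" using inv_weyl[OF assms(2)] weyl_minus[OF assms(2)] by metis
          then show False using assms(3) c notin_neg by simp
        qed
        then have "sref a (- x c) \<in> Rp" using simple_sref_pos[OF assms(1) xc] by simp
        then show ?thesis using 3 c notin_neg by (force simp: sref_minus_arg)
      qed
    next
      case False
      then show ?thesis using assms(3) by auto
    qed
  qed
  moreover have "inv x a \<notin> {c\<in>Rp. x c \<notin> Rp}" using assms by (simp add: weyl_inv simple_Rp)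
  ultimately show ?thesis by (simp add: invs_def finRp)
qed

lemma word_prod_weyl: "set ss \<subseteq> R \<Longrightarrow> word_prod ss \<in> weyl R"
  by (induction ss) (simp_all add: weyl.weyl_id left_weyl)

text \<open>Descent on height: a positive root that is not simple has positive inner product with
  some simple \<open>b\<close>, since otherwise \<open>a \<bullet> a\<close> would be nonpositive.
  Then \<open>sref b a\<close> is lower, and its reflection is conjugate to \<open>sref a\<close>
  under \<open>sref b\<close>.\<close>

lemma sref_is_word:
  "a \<in> Rp \<Longrightarrow> \<exists>ss. set ss \<subseteq> simple_roots Rp \<and> sref a = word_prod ss"
proof (induction a rule: Rp_induct)
  case (less a)
  show ?case
  proof (cases "a \<in> simple_roots Rp")
    case True
    then have "set [a] \<subseteq> simple_roots Rp" by simp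
    moreover have "sref a = word_prod [a]" unfolding word_prod.simps comp_id ..
    ultimately show ?thesis by (intro exI conjI)
  next
    case False
    have "\<exists>b\<in>simple_roots Rp. a \<bullet> b > 0"
    proof (rule ccontr)
      assume "\<not> ?thesis"
      then have "(- a) \<bullet> b \<ge> 0" if "b \<in> simple_roots Rp" for b
        using that by (simp add: not_less)
      then have "(- a) \<bullet> a \<ge> 0" 
        using nonneg_on_simple less.hyps by blast
      then show False using Rp_nz[OF less.hyps] by (simp add: inner_gt_zero_iff[symmetric] not_le[symmetric])
    qed
    then obtain b where b: "b \<in> simple_roots Rp" "a \<bullet> b > 0" by blast
    let ?c = "sref b a"
    have bR: "b \<in> R" using b simple_R by simp
    have c: "?c \<in> Rp" using simple_sref_pos b less.hyps False by blast
    have "pair a b > 0" using b bR by (simp add: pair_pos_iff root_nz)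
    then have "?c \<bullet> v < a \<bullet> v" using Rp_pos[OF simple_Rp[OF b(1)]]
      by (simp add: sref_def inner_diff_left)
    then obtain ss where ss: "set ss \<subseteq> simple_roots Rp" "sref ?c = word_prod ss"
      using less.IH[OF c] by blast
    have "sref b \<circ> sref ?c \<circ> sref b = sref a \<circ> (sref b \<circ> sref b)"
      unfolding sref_conj_comp[OF bR] comp_assoc ..
    then have "sref a = sref b \<circ> sref ?c \<circ> sref b"
      using sref_sref[OF root_nz[OF bR]] by (simp add: fun_eq_iff)
    also have "\<dots> = word_prod ([b] @ ss @ [b])"
      unfolding word_prod_append word_prod.simps comp_id ss(2) comp_assoc ..
    finally have "sref a = word_prod ([b] @ ss @ [b])" .
    moreover have "set ([b] @ ss @ [b]) \<subseteq> simple_roots Rp" using ss(1) b(1) by simp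
    ultimately show ?thesis by (intro exI conjI)
  qed
qed

lemma weyl_is_word:
  "x \<in> weyl R \<Longrightarrow> \<exists>ss. set ss \<subseteq> simple_roots Rp \<and> x = word_prod ss"
proof (induction rule: weyl.induct)
  case weyl_id
  then show ?case by (intro exI[of _ "[]"]) auto
next
  case (weyl_step x a)
  obtain ss where ss: "set ss \<subseteq> simple_roots Rp" "x = word_prod ss" using weyl_step by blast
  have "\<exists>ts. set ts \<subseteq> simple_roots Rp \<and> sref a = word_prod ts"
    using sref_is_word[of a] sref_is_word[of "- a"] neg_Rp[OF weyl_step.hyps(2)] sref_minus_root[of a]
    by metis
  then obtain ts where "set ts \<subseteq> simple_roots Rp" "sref a = word_prod ts" by blast
  then have "set (ss @ ts) \<subseteq> simple_roots Rp" "x \<circ> sref a = word_prod (ss @ ts)"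
    using ss by (simp_all only: word_prod_append set_append Un_least)
  then show ?case by (intro exI conjI)
qed

text \<open>A simple reflection makes only its own root negative. Hence \<open>b\<close>,
  transported through the letters, must at some point equal the next letter, and that letter is
  deleted.\<close>

lemma exchange:
  assumes "set ts \<subseteq> simple_roots Rp" "b \<in> Rp" "inv (word_prod ts) b \<notin> Rp"
  shows "\<exists>us. length us + 1 = length ts \<and> set us \<subseteq> simple_roots Rp \<and> word_prod us = sref b \<circ> word_prod ts"
  using assms
proof (induction ts arbitrary: b)
  case Nil
  then show ?case by simp
next
  case (Cons t ts)
  have t: "t \<in> simple_roots Rp" "set ts \<subseteq> simple_roots Rp" using Cons.prems by auto
  have tR: "t \<in> R" using t simple_R by simp
  have W: "word_prod ts \<in> weyl R" using t simple_R by (intro word_prod_weyl) blast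
  show ?case
  proof (cases "b = t")
    case True
    have "word_prod ts = sref b \<circ> word_prod (t # ts)"
      unfolding True word_prod.simps left_left[OF tR] ..
    then show ?thesis using t(2) by (intro exI[of _ ts] conjI) (simp only: list.size)
  next
    case False
    have "sref t b \<in> Rp" using simple_sref_pos[OF t(1) Cons.prems(2) False] .
    moreover have "inv (word_prod ts) (sref t b) \<notin> Rp"
      using Cons.prems(3) unfolding word_prod.simps inv_left[OF W tR] .
    ultimately obtain us where us: "length us + 1 = length ts" "set us \<subseteq> simple_roots Rp"
      "word_prod us = sref (sref t b) \<circ> word_prod ts" using Cons.IH t by blast
    have "word_prod (t # us) = (sref t \<circ> sref (sref t b)) \<circ> word_prod ts"
      unfolding word_prod.simps us(3) comp_assoc ..
    also have "\<dots> = sref b \<circ> word_prod (t # ts)"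
      unfolding word_prod.simps sref_conj_comp[OF tR] comp_assoc ..
    finally have "word_prod (t # us) = sref b \<circ> word_prod (t # ts)" .
    moreover have "length (t # us) + 1 = length (t # ts)" "set (t # us) \<subseteq> simple_roots Rp"
      using us(1,2) t by auto
    ultimately show ?thesis by (intro exI[of _ "t # us"] conjI)
  qed
qed

text \<open>If the first letter of a shortest word failed to add an inversion,
  \<open>exchange\<close> would remove a letter from the rest and give a shorter word.\<close>

lemma reduced_word_length:
  assumes "set ss \<subseteq> simple_roots Rp"
    "\<And>us. set us \<subseteq> simple_roots Rp \<Longrightarrow> word_prod us = word_prod ss \<Longrightarrow> length ss \<le> length us"
  shows "invs (word_prod ss) = length ss"
  using assms
proof (induction ss)
  case Nil
  then show ?case by (simp add: invs_def)
next
  case (Cons t ts)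
  have t: "t \<in> simple_roots Rp" "set ts \<subseteq> simple_roots Rp" using Cons.prems by auto
  have W: "word_prod ts \<in> weyl R" using t simple_R by (intro word_prod_weyl) blast
  have "length ts \<le> length us" if "set us \<subseteq> simple_roots Rp" "word_prod us = word_prod ts" for us
    using Cons.prems(2)[of "t # us"] that t by simp
  then have IH: "invs (word_prod ts) = length ts" using Cons.IH t by blast
  have "inv (word_prod ts) t \<in> Rp"
  proof (rule ccontr)
    assume "\<not> ?thesis"
    then obtain us where "length us + 1 = length ts" "set us \<subseteq> simple_roots Rp"
      "word_prod us = sref t \<circ> word_prod ts"
      using exchange[OF t(2) simple_Rp[OF t(1)]] by blast
    then show False using Cons.prems(2)[of us] by simp
  qed
  then show ?case
    unfolding word_prod.simps using invs_left_up[OF t(1) W] IH by (simp only: list.size One_nat_def)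
qed

lemma wlen_invs:
  assumes "x \<in> weyl R"
  shows "wlen Rp x = invs x"
proof -
  let ?P = "\<lambda>n. \<exists>ss. length ss = n \<and> set ss \<subseteq> simple_roots Rp \<and> x = word_prod ss"
  have "\<exists>n. ?P n" using weyl_is_word[OF assms] by blast
  then have "?P (wlen Rp x)" unfolding wlen_def foldr_word_prod by (rule LeastI_ex)
  then obtain ss where ss: "length ss = wlen Rp x" "set ss \<subseteq> simple_roots Rp" "x = word_prod ss" by blast
  have "length ss \<le> length us" if "set us \<subseteq> simple_roots Rp" "word_prod us = word_prod ss" for us
    unfolding ss(1) wlen_def foldr_word_prod using that ss(3) by (intro Least_le) auto
  then show ?thesis using reduced_word_length[OF ss(2)] ss by metis
qed

end

section \<open>Edges of the quantum Bruhat graph\<close>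


context root_sys
begin

text \<open>The inversion set of the reflection in \<open>b\<close>. It carries the involution
  \<open>g \<mapsto> - sref b g\<close>, whose only fixed point is \<open>b\<close>; edges are
  analysed by pairing roots along it.\<close>

definition flips :: "'a \<Rightarrow> 'a set" where
  "flips b = {g\<in>Rp. sref b g \<notin> Rp}"

lemma finite_flips: "finite (flips b)"
  by (simp add: flips_def finRp)

lemma flips_self: "b \<in> Rp \<Longrightarrow> b \<in> flips b"
  by (simp add: flips_def sref_self Rp_nz notin_neg)

lemma flips_Rp: "g \<in> flips b \<Longrightarrow> g \<in> Rp"
  by (simp add: flips_def)

lemma flips_neg: "b \<in> Rp \<Longrightarrow> g \<in> flips b \<Longrightarrow> - sref b g \<in> flips b"
  using neg_Rp[OF sref_root[of b g]] notin_neg[of g]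
  by (simp add: flips_def Rp_R sref_minus_arg sref_sref Rp_nz)

lemma flips_neg_neg: "b \<in> Rp \<Longrightarrow> - sref b (- sref b g) = g"
  by (simp add: sref_minus_arg sref_sref Rp_nz)

lemma flips_neg_self: "b \<in> Rp \<Longrightarrow> - sref b b = b"
  by (simp add: sref_self Rp_nz)

lemma flips_neg_image: "b \<in> Rp \<Longrightarrow> (\<lambda>g. - sref b g) ` flips b = flips b"
proof -
  assume b: "b \<in> Rp"
  have "g \<in> (\<lambda>g. - sref b g) ` flips b" if "g \<in> flips b" for g
    using flips_neg[OF b that] flips_neg_neg[OF b, of g] by (metis image_eqI)
  then show ?thesis using flips_neg[OF b] by blast
qed

lemma inj_neg_sref: "b \<in> Rp \<Longrightarrow> inj_on (\<lambda>g. - sref b g) A"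
  by (rule inj_on_inverseI[of _ "\<lambda>g. - sref b g"]) (simp add: flips_neg_neg)

lemma flips_pair_ge1:
  assumes "b \<in> Rp" "g \<in> flips b"
  shows "pair g b \<ge> 1"
proof -
  have "g \<in> R" "b \<in> R" "g \<in> Rp" using assms Rp_R flips_Rp by auto
  obtain m :: int where m: "pair g b = of_int m" using pair_int[OF \<open>b \<in> R\<close> \<open>g \<in> R\<close>] by (auto elim: Ints_cases)
  have "sref b g \<bullet> v < 0"
    using assms v_nonzero[of "sref b g"] Rp_iff[of "sref b g"] sref_root[OF \<open>b \<in> R\<close> \<open>g \<in> R\<close>]
    by (force simp: flips_def)
  then have "pair g b * (b \<bullet> v) > 0" using Rp_pos[OF \<open>g \<in> Rp\<close>] by (simp add: sref_def inner_diff_left)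
  then have "pair g b > 0" using Rp_pos[OF assms(1)] by (simp add: zero_less_mult_iff)
  then show ?thesis using m by simp
qed

lemma flips_sum: "g + (- sref b g) = pair g b *\<^sub>R b"
  by (simp add: sref_def)

lemma sref_nonflips:
  assumes "b \<in> Rp"
  shows "sref b ` (Rp - flips b) = Rp - flips b"
proof -
  have 1: "sref b g \<in> Rp - flips b" if "g \<in> Rp - flips b" for g
    using that assms by (auto simp: flips_def sref_sref Rp_nz)
  then have "g \<in> sref b ` (Rp - flips b)" if "g \<in> Rp - flips b" for g
    using that by (metis Rp_nz assms image_eqI sref_sref)
  then show ?thesis using 1 by blast
qed

lemma inj_sref: "b \<in> Rp \<Longrightarrow> inj_on (sref b) A"
  by (rule inj_on_inverseI[of _ "sref b"]) (simp add: sref_sref Rp_nz)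

lemma sum_nonflips:
  assumes "b \<in> Rp"
  shows "(\<Sum>g\<in>Rp - flips b. f (sref b g)) = (\<Sum>g\<in>Rp - flips b. f g)"
  using sum.reindex[OF inj_sref[OF assms], of f "Rp - flips b"] sref_nonflips[OF assms] by simp

lemma sum_flips:
  assumes "b \<in> Rp"
  shows "(\<Sum>g\<in>flips b. f (- sref b g)) = (\<Sum>g\<in>flips b. f g)"
  using sum.reindex[OF inj_neg_sref[OF assms], of f "flips b"] flips_neg_image[OF assms] by simp

lemma sum_split_flips: "sum f Rp = sum f (Rp - flips b) + sum f (flips b)"
  by (rule sum.subset_diff) (auto simp: finRp flips_Rp)

definition root_sign :: "'a \<Rightarrow> real" where
  "root_sign a = (if a \<in> Rp then 1 else -1)"

text \<open>Positive roots outside \<open>flips b\<close> are permuted by \<open>sref b\<close> and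
  cancel. On \<open>flips b\<close> the involution turns inversions of
  \<open>x \<circ> sref b\<close> into non-inversions of \<open>x\<close>, so each root contributes
  the sign of its image.\<close>

lemma invs_diff:
  assumes "x \<in> weyl R" "b \<in> Rp"
  shows "real (invs (x \<circ> sref b)) - real (invs x) = (\<Sum>g\<in>flips b. root_sign (x g))"
proof -
  let ?f = "\<lambda>a. if x a \<notin> Rp then 1 else 0 :: real"
  have inv: "real (invs y) = (\<Sum>g\<in>Rp. if y g \<notin> Rp then 1 else 0)" for y
    by (simp add: invs_def sum.If_cases[OF finRp] Int_def)
  have "(\<Sum>g\<in>flips b. ?f (sref b g)) = (\<Sum>g\<in>flips b. if x (- sref b g) \<in> Rp then 1 else 0)"
  proof (rule sum.cong[OF refl])
    fix g assume "g \<in> flips b"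
    then have "x (sref b g) \<in> R" using weyl_root sref_root assms Rp_R flips_Rp by simp
    then show "?f (sref b g) = (if x (- sref b g) \<in> Rp then 1 else 0)"
      using neg_Rp[of "x (sref b g)"] by (simp add: weyl_minus[OF assms(1)])
  qed
  also have "\<dots> = (\<Sum>g\<in>flips b. if x g \<in> Rp then 1 else 0)"
    by (rule sum_flips[OF assms(2)])
  finally have "(\<Sum>g\<in>flips b. ?f (sref b g)) = (\<Sum>g\<in>flips b. if x g \<in> Rp then 1 else 0)" .
  then have "real (invs (x \<circ> sref b)) - real (invs x)
      = (\<Sum>g\<in>flips b. if x g \<in> Rp then 1 else 0) - (\<Sum>g\<in>flips b. ?f g)"
    using sum_split_flips[of "\<lambda>g. ?f (sref b g)" b] sum_split_flips[of ?f b]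
      sum_nonflips[OF assms(2), of ?f] by (simp add: inv)
  also have "\<dots> = (\<Sum>g\<in>flips b. root_sign (x g))"
    unfolding sum_subtractf[symmetric] by (rule sum.cong) (auto simp: root_sign_def)
  finally show ?thesis .
qed

text \<open>Outside \<open>flips b\<close> the reflection permutes the positive roots and negates
  their pairing with \<open>b\<close>, so these contributions sum to zero.\<close>

lemma rho_flips:
  assumes "b \<in> Rp"
  shows "2 * pair (rho Rp) b = (\<Sum>g\<in>flips b. pair g b)"
proof -
  have "(\<Sum>g\<in>Rp - flips b. pair g b) = (\<Sum>g\<in>Rp - flips b. - pair g b)"
    using sum_nonflips[OF assms, of "\<lambda>g. pair g b"] by (simp add: pair_sref Rp_nz assms)
  then have "(\<Sum>g\<in>Rp - flips b. pair g b) = 0" by (simp add: sum_negf)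
  then show ?thesis
    using sum_split_flips[of "\<lambda>g. pair g b" b] by (simp add: rho_def pair_scale pair_sum)
qed

text \<open>Together with \<open>quantum\<close>, a form of the two length conditions in terms of
  signs. It lets an edge be followed under left multiplication without computing lengths.\<close>

definition bruhat :: "('a \<Rightarrow> 'a) \<Rightarrow> 'a \<Rightarrow> bool" where
  "bruhat x b \<longleftrightarrow> x b \<in> Rp \<and> (\<forall>g\<in>flips b - {b}. x g \<in> Rp \<longleftrightarrow> x (- sref b g) \<notin> Rp)"

definition quantum :: "('a \<Rightarrow> 'a) \<Rightarrow> 'a \<Rightarrow> bool" where
  "quantum x b \<longleftrightarrow> (\<forall>g\<in>flips b. x g \<notin> Rp \<and> (g \<noteq> b \<longrightarrow> pair g b = 1))"

lemma x_flips_sum: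
  assumes "x \<in> weyl R"
  shows "x g + x (- sref b g) = pair g b *\<^sub>R x b"
  using flips_sum[of g b] linear_add[OF linear_weyl[OF assms]] linear_scale[OF linear_weyl[OF assms]]
  by metis

text \<open>The images of \<open>g\<close> and its partner add up to a positive multiple of
  \<open>x b\<close>, so one of them has the sign of \<open>x b\<close>. The sum is therefore at
  least 1 if \<open>x b\<close> is positive, with equality only if all pairs cancel, and at most -1
  otherwise.\<close>

lemma bruhat_iff:
  assumes x: "x \<in> weyl R" and b: "b \<in> Rp"
  shows "(\<Sum>g\<in>flips b. root_sign (x g)) = 1 \<longleftrightarrow> bruhat x b"
proof -
  let ?N = "flips b - {b}"
  let ?h = "\<lambda>g. root_sign (x g) + root_sign (x (- sref b g))"
  have fin: "finite ?N" using finite_flips by simp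
  have reidx: "(\<Sum>g\<in>?N. root_sign (x (- sref b g))) = (\<Sum>g\<in>?N. root_sign (x g))"
    using sum_flips[OF b, of "\<lambda>g. root_sign (x g)"]
    by (simp add: sum_diff1 finite_flips flips_self[OF b] flips_neg_self[OF b])
  have tot: "2 * (\<Sum>g\<in>flips b. root_sign (x g)) = 2 * root_sign (x b) + (\<Sum>g\<in>?N. ?h g)"
    by (simp add: sum.distrib reidx sum.remove[OF finite_flips flips_self[OF b]])
  have vsum: "x g \<bullet> v + x (- sref b g) \<bullet> v = pair g b * (x b \<bullet> v)" for g
    using x_flips_sum[OF x, of g b] by (metis inner_add_left inner_scaleR_left)
  have inR: "x g \<in> R" "x (- sref b g) \<in> R" if "g \<in> ?N" for g
    using that weyl_root[OF x Rp_R[OF flips_Rp]] flips_neg[OF b] by blast+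
  have xb: "x b \<in> R" using weyl_root[OF x] Rp_R[OF b] by simp
  show ?thesis
  proof (cases "x b \<in> Rp")
    case True
    have h: "?h g \<ge> 0 \<and> (?h g = 0 \<longleftrightarrow> (x g \<in> Rp \<longleftrightarrow> x (- sref b g) \<notin> Rp))" if g: "g \<in> ?N" for g
    proof -
      have "pair g b * (x b \<bullet> v) > 0" using flips_pair_ge1[OF b, of g] g Rp_pos[OF True] by simp
      then have "x g \<in> Rp \<or> x (- sref b g) \<in> Rp"
        using vsum[of g] inR[OF g] by (auto simp: Rp_iff)
      then show ?thesis by (auto simp: root_sign_def)
    qed
    have "root_sign (x b) = 1" using True by (simp add: root_sign_def)
    then have "(\<Sum>g\<in>flips b. root_sign (x g)) = 1 \<longleftrightarrow> (\<Sum>g\<in>?N. ?h g) = 0"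
      using tot by (intro iffI) linarith+
    also have "\<dots> \<longleftrightarrow> (\<forall>g\<in>?N. ?h g = 0)" using h fin by (intro sum_nonneg_eq_0_iff) auto
    finally show ?thesis using h True by (auto simp: bruhat_def)
  next
    case False
    have "?h g \<le> 0" if g: "g \<in> ?N" for g
    proof -
      have "x b \<bullet> v < 0" using False xb v_nonzero[OF xb] by (simp add: Rp_iff)
      then have "pair g b * (x b \<bullet> v) < 0" using flips_pair_ge1[OF b, of g] g
        by (simp add: mult_less_0_iff)
      then have "x g \<notin> Rp \<or> x (- sref b g) \<notin> Rp"
        using vsum[of g] inR[OF g] by (auto simp: Rp_iff)
      then show ?thesis by (auto simp: root_sign_def)
    qed
    then have "(\<Sum>g\<in>?N. ?h g) \<le> 0" by (rule sum_nonpos)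
    moreover have "root_sign (x b) = -1" using False by (simp add: root_sign_def)
    ultimately have "(\<Sum>g\<in>flips b. root_sign (x g)) \<noteq> 1" using tot by linarith
    then show ?thesis using False by (simp add: bruhat_def)
  qed
qed

text \<open>An extremal case: every \<open>?h g\<close> is nonnegative, because signs are at least
  -1 and pairings at least 1. The correction at \<open>g = b\<close> accounts for
  \<open>pair b b = 2\<close>.\<close>

lemma quantum_iff:
  assumes x: "x \<in> weyl R" and b: "b \<in> Rp"
  shows "(\<Sum>g\<in>flips b. root_sign (x g)) = 1 - 2 * pair (rho Rp) b \<longleftrightarrow> quantum x b"
proof -
  let ?h = "\<lambda>g. root_sign (x g) + pair g b - (if g = b then 1 else 0)"
  have h: "?h g \<ge> 0 \<and> (?h g = 0 \<longleftrightarrow> x g \<notin> Rp \<and> (g \<noteq> b \<longrightarrow> pair g b = 1))" if "g \<in> flips b" for g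
    using flips_pair_ge1[OF b that] pair_self[OF Rp_nz[OF b]] by (auto simp: root_sign_def)
  have "(\<Sum>g\<in>flips b. ?h g) = (\<Sum>g\<in>flips b. root_sign (x g)) + 2 * pair (rho Rp) b - 1"
    by (simp add: sum_subtractf sum.distrib rho_flips[OF b] sum.delta finite_flips flips_self[OF b])
  then have "(\<Sum>g\<in>flips b. root_sign (x g)) = 1 - 2 * pair (rho Rp) b \<longleftrightarrow> (\<Sum>g\<in>flips b. ?h g) = 0" by (intro iffI) linarith+
  also have "\<dots> \<longleftrightarrow> (\<forall>g\<in>flips b. ?h g = 0)"
    using h finite_flips by (intro sum_nonneg_eq_0_iff) auto
  finally show ?thesis using h by (auto simp: quantum_def)
qed

abbreviation edge :: "('a \<Rightarrow> 'a) \<Rightarrow> 'a \<Rightarrow> bool" where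
  "edge x b \<equiv> qbg_edge R Rp x b (x \<circ> sref b)"

lemma edge_iff: "edge x b \<longleftrightarrow> x \<in> weyl R \<and> b \<in> Rp \<and> (bruhat x b \<or> quantum x b)"
proof (cases "x \<in> weyl R \<and> b \<in> Rp")
  case True
  then have x: "x \<in> weyl R" and b: "b \<in> Rp" by auto
  have y: "x \<circ> sref b \<in> weyl R" using x b weyl.weyl_step Rp_R by blast
  have "wlen Rp (x \<circ> sref b) = wlen Rp x + 1 \<longleftrightarrow> (\<Sum>g\<in>flips b. root_sign (x g)) = 1"
    unfolding wlen_invs[OF x] wlen_invs[OF y] invs_diff[OF x b, symmetric] by (intro iffI) linarith+
  moreover have "real (wlen Rp (x \<circ> sref b)) = real (wlen Rp x) - 2 * pair (rho Rp) b + 1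
      \<longleftrightarrow> (\<Sum>g\<in>flips b. root_sign (x g)) = 1 - 2 * pair (rho Rp) b"
    unfolding wlen_invs[OF x] wlen_invs[OF y] invs_diff[OF x b, symmetric] by (intro iffI) linarith+
  ultimately show ?thesis
    using x b y bruhat_iff[OF x b] quantum_iff[OF x b] unfolding qbg_edge_def by blast
next
  case False
  then show ?thesis by (auto simp: qbg_edge_def)
qed

lemma edge_invs_le:
  assumes "edge x b"
  shows "invs (x \<circ> sref b) \<le> invs x + 1"
proof -
  have x: "x \<in> weyl R" and b: "b \<in> Rp" using assms by (auto simp: edge_iff)
  have "(\<Sum>g\<in>flips b. pair g b) \<ge> 0"
    using flips_pair_ge1[OF b] by (intro sum_nonneg) force
  then have "(\<Sum>g\<in>flips b. root_sign (x g)) \<le> 1"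
    using assms bruhat_iff[OF x b] quantum_iff[OF x b] rho_flips[OF b] by (auto simp: edge_iff)
  then show ?thesis using invs_diff[OF x b] by linarith
qed

end

section \<open>Crossing walls\<close>


context root_sys
begin

text \<open>The highest root in a local form, maximal against adding a positive root; the downward
  induction in \<open>wall_closed_id\<close> stops at exactly these roots.\<close>

definition top_root :: "'a \<Rightarrow> bool" where
  "top_root t \<longleftrightarrow> t \<in> Rp \<and> (\<forall>a\<in>Rp. t + a \<notin> R)"

text \<open>Several irreducible components give several roots \<open>- e\<close>, one affine wall for each.\<close>

definition wall :: "'a \<Rightarrow> bool" where
  "wall e \<longleftrightarrow> e \<in> simple_roots Rp \<or> top_root (- e)"

lemma wall_R: "wall e \<Longrightarrow> e \<in> R"
  using neg_root_iff[of e] by (auto simp: wall_def top_root_def simple_R Rp_R)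

lemma top_pair_nonneg:
  assumes "top_root t" "a \<in> Rp"
  shows "pair a t \<ge> 0"
proof (rule ccontr)
  assume c: "\<not> ?thesis"
  have t: "t \<in> Rp" using assms by (simp add: top_root_def)
  have "pair a (- t) > 0" using c by (simp add: pair_minus_right)
  then have "a \<bullet> (- t) > 0" using pair_pos_iff[of "- t" a] Rp_nz[OF t] by simp
  moreover have "a \<noteq> - t" using notin_neg[OF t] assms(2) by auto
  ultimately have "a - (- t) \<in> R" using root_diff neg_root Rp_R t assms(2) by blast
  then show False using assms by (simp add: top_root_def add.commute)
qed

lemma top_diff:
  assumes "top_root t" "a \<in> Rp" "t - a \<in> R"
  shows "t - a \<in> Rp"
proof (rule ccontr)
  assume "t - a \<notin> Rp"
  then have "a - t \<in> Rp" using neg_Rp[OF assms(3)] by simp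
  moreover have "t + (a - t) \<in> R" using assms(2) Rp_R by simp
  ultimately show False using assms(1) unfolding top_root_def by blast
qed

text \<open>Larger values are excluded through the positive root \<open>t - a\<close>: for the value
  2 its sum with \<open>t\<close> is \<open>- sref t a\<close>, a root above \<open>t\<close>; for
  the value 3 its pairing with \<open>t\<close> is -1.\<close>

lemma top_pair_le1:
  assumes "top_root t" "a \<in> Rp" "a \<noteq> t"
  shows "pair a t \<le> 1"
proof (rule ccontr)
  assume c: "\<not> ?thesis"
  have t: "t \<in> Rp" using assms by (simp add: top_root_def)
  note R = Rp_R[OF t] Rp_R[OF assms(2)]
  have p: "a \<bullet> t > 0" using c pair_pos_iff[of t a] Rp_nz[OF t] by auto
  then have "t - a \<in> R" using root_diff[OF R] assms(3) by (simp add: inner_commute)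
  then have d: "t - a \<in> Rp" using top_diff assms by blast
  have "pair a t = 2 \<or> pair a t = 3" using pair_bound[OF R(2,1) assms(3) p] c by auto
  then show False
  proof
    assume "pair a t = 2"
    then have "- (a - 2 *\<^sub>R t) \<in> R" using neg_root[OF sref_root[OF R]] by (simp add: sref_def)
    then have "t + (t - a) \<in> R" by (simp add: scaleR_2 algebra_simps)
    then show False using assms(1) d unfolding top_root_def by blast
  next
    assume "pair a t = 3"
    then have "pair (t - a) t = -1" by (simp add: pair_diff pair_self Rp_nz[OF t])
    then show False using top_pair_nonneg[OF assms(1) d] by simp
  qed
qed

text \<open>For a maximal root the pairing records exactly the change of sign under its reflection.
  This is the finite shadow of the affine simple reflection, which changes the sign of no affine
  root except plus or minus its own.\<close>

lemma top_cases:
  assumes "top_root t" "a \<in> R" "a \<noteq> t" "a \<noteq> - t"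
  obtains "pair a t = 0" "sref t a \<in> Rp \<longleftrightarrow> a \<in> Rp"
  | "pair a t = 1" "a \<in> Rp" "sref t a \<notin> Rp"
  | "pair a t = -1" "a \<notin> Rp" "sref t a \<in> Rp"
proof -
  have t: "t \<in> Rp" using assms by (simp add: top_root_def)
  have *: "pair c t = 0 \<or> (pair c t = 1 \<and> - sref t c \<in> Rp)" if "c \<in> Rp" "c \<noteq> t" for c
  proof -
    obtain m :: int where m: "pair c t = of_int m" using pair_int[OF Rp_R[OF t] Rp_R[OF \<open>c \<in> Rp\<close>]] by (auto elim: Ints_cases)
    have "m = 0 \<or> m = 1" using top_pair_le1[OF assms(1) that] top_pair_nonneg[OF assms(1) that(1)] m by auto
    moreover have "- sref t c \<in> Rp" if "m = 1"
    proof -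
      have "t - c = - sref t c" using that m by (simp add: sref_def)
      then show ?thesis 
        using top_diff[OF assms(1) \<open>c \<in> Rp\<close>] neg_root[OF sref_root[OF Rp_R[OF t] Rp_R[OF \<open>c \<in> Rp\<close>]]]
        by simp
    qed
    ultimately show ?thesis using m by auto
  qed
  have z: "pair a t = 0 \<Longrightarrow> sref t a = a" by (simp add: sref_def)
  show thesis
  proof (cases "a \<in> Rp")
    case True
    then show thesis using *[OF True assms(3)] z that notin_neg[of "- sref t a"] by auto
  next
    case False
    then have "- a \<in> Rp" "- a \<noteq> t" using neg_Rp[OF assms(2)] assms(4) by auto
    from *[OF this] show thesis using z that False by (auto simp: pair_minus sref_minus_arg)
  qed
qed

lemma simple_sign:
  assumes "e \<in> simple_roots Rp" "a \<in> R" "a \<noteq> e" "a \<noteq> - e"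
  shows "sref e a \<in> Rp \<longleftrightarrow> a \<in> Rp"
proof (cases "a \<in> Rp")
  case True
  then show ?thesis using simple_sref_pos assms by blast
next
  case False
  then have "- a \<in> Rp" "- a \<noteq> e" using neg_Rp[OF assms(2)] assms(4) by auto
  then have "sref e (- a) \<in> Rp" using simple_sref_pos assms by blast
  then show ?thesis using False notin_neg[of "- sref e a"] by (simp add: sref_minus_arg)
qed

lemma weyl_eq_iff: "x \<in> weyl R \<Longrightarrow> x g = e \<longleftrightarrow> g = inv x e"
  using weyl_inv inv_weyl by metis

text \<open>As \<open>inv x e\<close> keeps its sign under \<open>sref b\<close>, neither it nor its
  negative lies in \<open>flips b\<close>. This rules out the exceptional roots of
  \<open>simple_sign\<close> and \<open>top_cases\<close> among the images
  \<open>x g\<close>.\<close>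

lemma flips_ne:
  assumes "x \<in> weyl R" "e \<in> R" "inv x e \<in> Rp \<longleftrightarrow> sref b (inv x e) \<in> Rp" "b \<in> R" "g \<in> flips b"
  shows "x g \<noteq> e" "x g \<noteq> - e"
proof -
  have d: "inv x e \<in> R" using inv_root assms by blast
  have d': "sref b (inv x e) \<in> R" using sref_root d assms(4) by blast
  show "x g \<noteq> e" using assms weyl_eq_iff[of x g e] by (auto simp: flips_def)
  show "x g \<noteq> - e"
    using assms weyl_eq_iff[of x g "- e"] inv_weyl_minus[OF assms(1), of e] neg_Rp[OF d] neg_Rp[OF d']
    by (auto simp: flips_def sref_minus_arg)
qed

text \<open>In \<open>flips (inv x e)\<close> the partner of \<open>g\<close> is sent to
  \<open>- sref e (x g)\<close>. For simple \<open>e\<close> the reflection keeps signs, which is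
  the Bruhat condition. For maximal \<open>- e\<close> the pairing of \<open>x g\<close> with
  \<open>- e\<close> is at most -1, so \<open>top_cases\<close> leaves only its third case, the
  quantum condition.\<close>

lemma wall_jump:
  assumes w: "wall e" and x: "x \<in> weyl R" and d: "inv x e \<in> Rp"
  shows "edge x (inv x e)"
proof -
  let ?d = "inv x e"
  have xd: "x ?d = e" using weyl_inv[OF x] .
  have xs: "x (sref ?d g) = sref e (x g)" for g
    using sref_conj[OF orthogonal_weyl[OF x], of ?d g] xd by simp
  have ne: "x g \<noteq> e" "x g \<noteq> - e" if "g \<in> flips ?d - {?d}" for g
    using that weyl_eq_iff[OF x, of g] inv_weyl_minus[OF x, of e] notin_neg[OF d] flips_Rp[of g ?d] by auto
  have gR: "x g \<in> R" if "g \<in> flips ?d" for g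
    using that weyl_root[OF x] flips_Rp Rp_R by blast
  from w have "bruhat x ?d \<or> quantum x ?d" unfolding wall_def
  proof
    assume s: "e \<in> simple_roots Rp"
    have "x g \<in> Rp \<longleftrightarrow> x (- sref ?d g) \<notin> Rp" if g: "g \<in> flips ?d - {?d}" for g
    proof -
      have "sref e (x g) \<in> R" using sref_root[OF wall_R[OF w]] gR g by blast
      then show ?thesis
        using simple_sign[OF s gR ne[OF g]] g neg_Rp[of "sref e (x g)"]
        by (simp add: weyl_minus[OF x] xs)
    qed
    then show ?thesis using s xd simple_Rp by (simp add: bruhat_def)
  next
    assume t: "top_root (- e)"
    have "x g \<notin> Rp \<and> (g \<noteq> ?d \<longrightarrow> pair g ?d = 1)" if g: "g \<in> flips ?d" for g
    proof (cases "g = ?d")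
      case True
      then show ?thesis using xd t notin_neg[of "- e"] by (simp add: top_root_def)
    next
      case False
      have "pair (x g) (- e) = - pair g ?d"
        using pair_orthogonal[OF orthogonal_weyl[OF x], of g ?d] by (simp add: xd pair_minus_right)
      then show ?thesis
        using flips_pair_ge1[OF d g] ne[of g] g False
        by - (rule top_cases[OF t gR[OF g]]; force)
    qed
    then show ?thesis by (simp add: quantum_def)
  qed
  then show ?thesis using x d by (simp add: edge_iff)
qed

text \<open>Suppose \<open>b\<close> is another root; \<open>x b\<close> has positive inner product
  with \<open>e\<close>. A Bruhat edge then contradicts that a simple \<open>e\<close> does not
  split, or that a maximal \<open>- e\<close> pairs nonnegatively with positive roots. A quantum
  edge contradicts the sign of a simple \<open>e\<close> or, for maximal \<open>- e\<close>,
  \<open>top_diff\<close>.\<close>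

lemma wall_crossing:
  assumes w: "wall e" and ed: "edge x b" and d: "inv x e \<in> Rp" "sref b (inv x e) \<notin> Rp"
  shows "b = inv x e"
proof (rule ccontr)
  let ?d = "inv x e"
  assume ne: "b \<noteq> ?d"
  have x: "x \<in> weyl R" and b: "b \<in> Rp" and cases: "bruhat x b \<or> quantum x b" using ed by (auto simp: edge_iff)
  have xd: "x ?d = e" using weyl_inv[OF x] .
  have df: "?d \<in> flips b" using d by (simp add: flips_def)
  have k: "pair ?d b \<ge> 1" using flips_pair_ge1[OF b df] .
  have kx: "pair e (x b) = pair ?d b"
    using pair_orthogonal[OF orthogonal_weyl[OF x], of ?d b] by (simp add: xd)
  have xb: "x b \<in> R" using weyl_root[OF x Rp_R[OF b]] .
  have xs: "x (- sref b ?d) = - (e - pair ?d b *\<^sub>R x b)"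
    using x_flips_sum[OF x, of ?d b] xd by (simp add: algebra_simps)
  have pos: "e \<bullet> x b > 0" using k kx pair_pos_iff[OF root_nz[OF xb], of e] by simp
  from w show False unfolding wall_def
  proof
    assume s: "e \<in> simple_roots Rp"
    then have eR: "e \<in> Rp" using simple_Rp by simp
    from cases show False
    proof
      assume "quantum x b"
      then show False using df xd eR by (auto simp: quantum_def)
    next
      assume br: "bruhat x b"
      have xbp: "x b \<in> Rp" using br by (simp add: bruhat_def)
      have "?d \<in> flips b - {b}" using df ne by blast
      then have "x ?d \<in> Rp \<longleftrightarrow> x (- sref b ?d) \<notin> Rp" using br unfolding bruhat_def by blast
      then have n: "x (- sref b ?d) \<notin> Rp" using eR unfolding xd by simp
      have "e \<noteq> x b" using ne weyl_eq_iff[OF x, of b e] by auto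
      then have r: "e - x b \<in> R" using root_diff[OF Rp_R[OF eR] xb _ pos] by simp
      have "e - x b \<notin> Rp"
      proof
        assume "e - x b \<in> Rp"
        moreover have "e = (e - x b) + x b" by simp
        ultimately show False using s xbp unfolding simple_roots_def by blast
      qed
      then have "(e - x b) \<bullet> v < 0" using v_nonzero[OF r] Rp_iff[OF r] by linarith
      moreover have "(pair ?d b - 1) * (x b \<bullet> v) \<ge> 0" using k Rp_pos[OF xbp] by simp
      ultimately have "x (- sref b ?d) \<bullet> v > 0"
        unfolding xs by (simp add: inner_diff_left algebra_simps)
      moreover have "x (- sref b ?d) \<in> R"
        using weyl_root[OF x] flips_neg[OF b df] flips_Rp Rp_R by blast
      ultimately show False using n Rp_iff by blast
    qed
  next
    assume t: "top_root (- e)"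
    then have eR: "e \<notin> Rp" using notin_neg[of "- e"] by (auto simp: top_root_def)
    from cases show False
    proof
      assume "bruhat x b"
      then have "x b \<in> Rp" by (simp add: bruhat_def)
      then have "pair (x b) (- e) \<ge> 0" using top_pair_nonneg[OF t] by simp
      moreover have "pair (x b) e > 0"
        using pos pair_pos_iff[of e "x b"] root_nz[OF wall_R[OF w]] by (simp add: inner_commute)
      ultimately show False by (simp add: pair_minus_right)
    next
      assume q: "quantum x b"
      have 1: "pair ?d b = 1" using q df ne unfolding quantum_def by metis
      have n: "x (- sref b ?d) \<notin> Rp" using q flips_neg[OF b df] unfolding quantum_def by blast
      have xbn: "x b \<notin> Rp" using q flips_self[OF b] unfolding quantum_def by blast
      have "- x b \<in> Rp" using xbn neg_Rp[OF xb] by simp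
      moreover have "x (- sref b ?d) \<in> R"
        using weyl_root[OF x] flips_neg[OF b df] flips_Rp Rp_R by blast
      ultimately show False using top_diff[OF t, of "- x b"] n by (simp add: xs 1)
    qed
  qed
qed

text \<open>A simple wall keeps all signs involved. For maximal \<open>- e\<close> the type of the
  edge may change: \<open>tau b = 1\<close> turns a Bruhat edge into a quantum edge, and
  \<open>tau b = -1\<close> does the reverse.\<close>

lemma wall_reflect:
  assumes w: "wall e" and ed: "edge x b" and d: "inv x e \<in> Rp \<longleftrightarrow> sref b (inv x e) \<in> Rp"
  shows "edge (sref e \<circ> x) b"
proof -
  have x: "x \<in> weyl R" and b: "b \<in> Rp" and cases: "bruhat x b \<or> quantum x b" using ed by (auto simp: edge_iff)
  have eR: "e \<in> R" using wall_R[OF w] .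
  have gR: "x g \<in> R" if "g \<in> flips b" for g
    using that weyl_root[OF x] flips_Rp Rp_R by blast
  note ne = flips_ne[OF x eR d Rp_R[OF b]]
  have "bruhat (sref e \<circ> x) b \<or> quantum (sref e \<circ> x) b"
    using w unfolding wall_def
  proof
    assume s: "e \<in> simple_roots Rp"
    have "sref e (x g) \<in> Rp \<longleftrightarrow> x g \<in> Rp" if "g \<in> flips b" for g
      using simple_sign[OF s gR[OF that]] ne[OF that] by blast
    then show ?thesis
      using cases flips_neg[OF b] flips_self[OF b] by (simp add: bruhat_def quantum_def)
  next
    assume t: "top_root (- e)"
    \<comment> \<open>\<open>tau\<close> is additive along
      \<open>x g + x (- sref b g) = pair g b *\<^sub>R x b\<close> and takes only the values -1, 0,
      1 on \<open>flips b\<close>. With the signs given by the edge this leaves few cases, and it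
      forces \<open>pair g b = 1\<close> when the type becomes quantum.\<close>
    define tau where "tau g = pair (x g) (- e)" for g
    have C: "(tau g = 0 \<and> (sref e (x g) \<in> Rp \<longleftrightarrow> x g \<in> Rp))
        \<or> (tau g = 1 \<and> x g \<in> Rp \<and> sref e (x g) \<notin> Rp)
        \<or> (tau g = -1 \<and> x g \<notin> Rp \<and> sref e (x g) \<in> Rp)" if g: "g \<in> flips b" for g
      using ne[OF g] unfolding tau_def
      by - (rule top_cases[OF t gR[OF g]]; simp add: sref_minus_root)
    have tau_sum: "tau g + tau (- sref b g) = pair g b * tau b" for g
      unfolding tau_def pair_add[symmetric] x_flips_sum[OF x] pair_scale ..
    have nb: "- sref b g \<in> flips b" "pair g b \<ge> 1" if "g \<in> flips b" for g
      using flips_neg[OF b that] flips_pair_ge1[OF b that] by auto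
    note fb = flips_self[OF b]
    from cases show ?thesis
    proof
      assume br: "bruhat x b"
      then have xb: "x b \<in> Rp" by (simp add: bruhat_def)
      have brg: "x g \<in> Rp \<longleftrightarrow> x (- sref b g) \<notin> Rp" if "g \<in> flips b - {b}" for g
        using br that unfolding bruhat_def by blast
      consider "tau b = 0" | "tau b = 1" using C[OF fb] xb by auto
      then show ?thesis
      proof cases
        case 1
        have "sref e (x g) \<in> Rp \<longleftrightarrow> sref e (x (- sref b g)) \<notin> Rp" if g: "g \<in> flips b - {b}" for g
        proof -
          have gf: "g \<in> flips b" using g by blast
          show ?thesis using C[OF gf] C[OF nb(1)[OF gf]] nb(2)[OF gf] tau_sum[of g] brg[OF g] 1 by auto
        qed
        then have "bruhat (sref e \<circ> x) b" using C[OF fb] 1 xb by (simp add: bruhat_def)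
        then show ?thesis ..
      next
        case 2
        have "sref e (x g) \<notin> Rp \<and> pair g b = 1" if g: "g \<in> flips b - {b}" for g
        proof -
          have gf: "g \<in> flips b" using g by blast
          show ?thesis using C[OF gf] C[OF nb(1)[OF gf]] nb(2)[OF gf] tau_sum[of g] brg[OF g] 2 by auto
        qed
        then have "quantum (sref e \<circ> x) b" using C[OF fb] 2 by (auto simp add: quantum_def)
        then show ?thesis ..
      qed
    next
      assume q: "quantum x b"
      then have xb: "x b \<notin> Rp" using fb by (simp add: quantum_def)
      have qg: "x g \<notin> Rp \<and> x (- sref b g) \<notin> Rp \<and> (g \<noteq> b \<longrightarrow> pair g b = 1)" if "g \<in> flips b" for g
        using q that nb(1)[OF that] unfolding quantum_def by blast
      consider "tau b = 0" | "tau b = -1" using C[OF fb] xb by auto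
      then show ?thesis
      proof cases
        case 1
        have "sref e (x g) \<notin> Rp" if g: "g \<in> flips b" for g
        proof -
          note gf = g
          show ?thesis using C[OF gf] C[OF nb(1)[OF gf]] nb(2)[OF gf] tau_sum[of g] qg[OF g] 1 by auto
        qed
        then have "quantum (sref e \<circ> x) b" using q by (simp add: quantum_def)
        then show ?thesis ..
      next
        case 2
        have "sref e (x g) \<in> Rp \<longleftrightarrow> sref e (x (- sref b g)) \<notin> Rp" if g: "g \<in> flips b - {b}" for g
        proof -
          have gf: "g \<in> flips b" using g by blast
          show ?thesis using C[OF gf] C[OF nb(1)[OF gf]] nb(2)[OF gf] tau_sum[of g] qg[OF gf] g 2 by auto
        qed
        then have "bruhat (sref e \<circ> x) b" using C[OF fb] 2 by (auto simp add: bruhat_def)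
        then show ?thesis ..
      qed
    qed
  qed
  then show ?thesis using left_weyl[OF x eR] b by (simp add: edge_iff)
qed

end

section \<open>Monotone paths\<close>


locale refl_order = root_sys +
  fixes lt :: "'a \<Rightarrow> 'a \<Rightarrow> bool"
  assumes ro: "reflection_order Rp lt"
begin

section \<open>Convexity of a reflection order under reflections\<close>

lemma lt_irrefl: "a \<in> Rp \<Longrightarrow> \<not> lt a a"
  using ro by (simp add: reflection_order_def)

lemma lt_trans: "a \<in> Rp \<Longrightarrow> b \<in> Rp \<Longrightarrow> c \<in> Rp \<Longrightarrow> lt a b \<Longrightarrow> lt b c \<Longrightarrow> lt a c"
  using ro unfolding reflection_order_def by blast

lemma lt_asym: "a \<in> Rp \<Longrightarrow> b \<in> Rp \<Longrightarrow> lt a b \<Longrightarrow> \<not> lt b a"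
  using lt_irrefl lt_trans by blast

lemma lt_total: "a \<in> Rp \<Longrightarrow> b \<in> Rp \<Longrightarrow> a \<noteq> b \<Longrightarrow> lt a b \<or> lt b a"
  using ro unfolding reflection_order_def by blast

lemma lt_sum:
  assumes "a \<in> Rp" "b \<in> Rp" "a + b \<in> Rp"
  shows "(lt a (a + b) \<and> lt (a + b) b) \<or> (lt b (a + b) \<and> lt (a + b) a)"
  using ro assms unfolding reflection_order_def by blast

text \<open>The sum \<open>c + b\<close> lies between \<open>c\<close> and \<open>b\<close>, hence
  on the same side of \<open>b\<close> as \<open>c\<close>; adding \<open>b\<close> repeatedly never
  passes \<open>b\<close> in the order.\<close>

lemma lt_string:
  assumes "q \<in> Rp" "b \<in> Rp" "\<And>i. i \<le> n \<Longrightarrow> q + real i *\<^sub>R b \<in> R"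
  shows "(lt q b \<longrightarrow> lt (q + real n *\<^sub>R b) b) \<and> (lt b q \<longrightarrow> lt b (q + real n *\<^sub>R b))"
  using assms(3)
proof (induction n)
  case 0
  then show ?case by simp
next
  case (Suc n)
  have Rp: "q + real i *\<^sub>R b \<in> Rp" if "i \<le> Suc n" for i
  proof -
    have "(q + real i *\<^sub>R b) \<bullet> v > 0"
      using Rp_pos[OF assms(1)] Rp_pos[OF assms(2)] by (simp add: inner_add_left add_pos_nonneg)
    then show ?thesis using Suc.prems[OF that] Rp_iff by blast
  qed
  let ?c = "q + real n *\<^sub>R b"
  have c: "?c \<in> Rp" using Rp[of n] by simp
  have eq: "q + real (Suc n) *\<^sub>R b = ?c + b" by (simp add: algebra_simps)
  have cb: "?c + b \<in> Rp" using Rp[of "Suc n"] unfolding eq by simp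
  have IH: "(lt q b \<longrightarrow> lt ?c b) \<and> (lt b q \<longrightarrow> lt b ?c)" using Suc.IH Suc.prems by simp
  show ?case
    using lt_sum[OF c assms(2) cb] IH lt_asym[OF c assms(2)]
      lt_trans[OF c cb assms(2)] lt_trans[OF assms(2) cb c] unfolding eq by blast
qed

lemma nat_pair:
  assumes "a \<in> R" "b \<in> R" "pair a b \<ge> 0"
  obtains k where "pair a b = real k"
  using pair_int[OF assms(2,1)] assms(3) by (metis Ints_cases of_int_0_le_iff of_int_of_nat_eq zero_le_imp_eq_int)

lemma lt_sref_up:
  assumes "a \<in> Rp" "b \<in> Rp" "a \<noteq> b" "sref b a \<in> Rp" "pair a b \<le> 0"
  shows "(lt a b \<longrightarrow> lt (sref b a) b) \<and> (lt b a \<longrightarrow> lt b (sref b a))"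
proof -
  note R = assms(1,2)[THEN Rp_R]
  have "pair a (- b) \<ge> 0" using assms(5) by (simp add: pair_minus_right)
  then obtain k where k: "pair a (- b) = real k" using nat_pair[OF R(1) neg_root[OF R(2)]] by blast
  have ne: "a \<noteq> - b" using assms(1,2) notin_neg by blast
  have "a + real i *\<^sub>R b \<in> R" if "i \<le> k" for i
    using root_string[OF R(1) neg_root[OF R(2)] ne k that] by simp
  then have "(lt a b \<longrightarrow> lt (a + real k *\<^sub>R b) b) \<and> (lt b a \<longrightarrow> lt b (a + real k *\<^sub>R b))"
    by (rule lt_string[OF assms(1,2)])
  moreover have "sref b a = a + real k *\<^sub>R b"
    unfolding k[symmetric] pair_minus_right sref_def by simp
  ultimately show ?thesis by simp
qed

text \<open>Since \<open>sref b\<close> is an involution, the end with nonpositive pairing may be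
  taken as the start; from there the other end is reached by adding \<open>b\<close>.\<close>

lemma lt_sref:
  assumes "a \<in> Rp" "b \<in> Rp" "a \<noteq> b" "sref b a \<in> Rp"
  shows "lt a b \<longleftrightarrow> lt (sref b a) b"
proof -
  have ss: "sref b (sref b a) = a" using sref_sref[OF Rp_nz[OF assms(2)]] .
  have ne: "sref b a \<noteq> b"
    using ss sref_self[OF Rp_nz[OF assms(2)]] notin_neg[OF assms(2)] assms(1) by metis
  have asym: "lt a b \<longleftrightarrow> \<not> lt b a" "lt (sref b a) b \<longleftrightarrow> \<not> lt b (sref b a)"
    using lt_total lt_asym assms ne by metis+
  show ?thesis
  proof (cases "pair a b \<le> 0")
    case True
    then show ?thesis using lt_sref_up[OF assms] asym by blast
  next
    case False
    then have "pair (sref b a) b \<le> 0" by (simp add: pair_sref Rp_nz[OF assms(2)])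
    then show ?thesis using lt_sref_up[OF assms(4,2) ne] ss asym assms(1) by metis
  qed
qed

text \<open>Along the \<open>b\<close>-string from \<open>a\<close> to \<open>sref b a\<close> the sign changes between some \<open>p\<close> and \<open>- q\<close>, so \<open>b = p + q\<close>.\<close>

lemma lt_sref_neg:
  assumes "a \<in> Rp" "b \<in> Rp" "a \<noteq> b" "sref b a \<notin> Rp" "lt a b"
  shows "lt b (- sref b a)"
proof -
  obtain k j where k: "pair a b = real k" and j: "1 \<le> j" "j \<le> k"
    and p: "a - real (j - 1) *\<^sub>R b \<in> Rp" and q: "real j *\<^sub>R b - a \<in> Rp"
    using split_root[OF assms(1-4)] .
  let ?p = "a - real (j - 1) *\<^sub>R b" and ?q = "real j *\<^sub>R b - a"
  note R = assms(1,2)[THEN Rp_R]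
  have str: "a - real i *\<^sub>R b \<in> R" if "i \<le> k" for i
    using root_string[OF R assms(3) k that] .
  have "?p + real i *\<^sub>R b \<in> R" if "i \<le> j - 1" for i
  proof -
    have "real (j - 1) = real i + real (j - 1 - i)" using that by linarith
    then have eq: "?p + real i *\<^sub>R b = a - real (j - 1 - i) *\<^sub>R b"
      by (simp only: scaleR_add_left algebra_simps)
    show ?thesis unfolding eq by (rule str) (use j in simp)
  qed
  from lt_string[OF p assms(2) this] have "lt b ?p \<longrightarrow> lt b (?p + real (j - 1) *\<^sub>R b)" by blast
  then have "\<not> lt b ?p" using lt_asym[OF assms(1,2,5)] by simp
  have sum: "?p + ?q = b" using j by (simp add: of_nat_diff algebra_simps)
  have "lt b ?q" using lt_sum[OF p q] \<open>\<not> lt b ?p\<close> assms(2) unfolding sum by blast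
  have "?q + real i *\<^sub>R b \<in> R" if "i \<le> k - j" for i
  proof -
    have eq: "?q + real i *\<^sub>R b = - (a - real (j + i) *\<^sub>R b)" by (simp add: algebra_simps)
    show ?thesis unfolding eq by (rule neg_root[OF str]) (use j that in simp)
  qed
  from lt_string[OF q assms(2) this] \<open>lt b ?q\<close> have "lt b (?q + real (k - j) *\<^sub>R b)" by blast
  moreover have "?q + real (k - j) *\<^sub>R b = - sref b a"
    using j by (simp add: sref_def k of_nat_diff algebra_simps)
  ultimately show ?thesis by simp
qed

section \<open>Monotone paths reflected in a wall\<close>

abbreviation path :: "('a \<Rightarrow> 'a) \<Rightarrow> 'a list \<Rightarrow> ('a \<Rightarrow> 'a) \<Rightarrow> bool" where
  "path x gs y \<equiv> qbg_path R Rp x gs y \<and> sorted_wrt lt gs"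

lemma path_Cons: "path x (b # gs) y \<longleftrightarrow> edge x b \<and> path (x \<circ> sref b) gs y \<and> (\<forall>g\<in>set gs. lt b g)"
  by auto

lemma path_weyl: "path x gs y \<Longrightarrow> x \<in> weyl R"
  by (cases gs) (auto simp: edge_iff)

lemma path_Rp: "path x gs y \<Longrightarrow> set gs \<subseteq> Rp"
  by (induction gs arbitrary: x) (auto simp: edge_iff)

lemma path_end_weyl: "path x gs y \<Longrightarrow> y \<in> weyl R"
  by (induction gs arbitrary: x) auto

lemma inv_step: "edge x b \<Longrightarrow> inv (x \<circ> sref b) e = sref b (inv x e)"
  by (rule inv_right) (auto simp: edge_iff Rp_R)

lemma inv_reflect:
  assumes "wall e" "x \<in> weyl R"
  shows "inv (sref e \<circ> x) e = - inv x e"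
  unfolding inv_left[OF assms(2) wall_R[OF assms(1)]] sref_self[OF root_nz[OF wall_R[OF assms(1)]]]
  by (rule inv_weyl_minus[OF assms(2)])

lemma inv_reflect_Rp:
  assumes "wall e" "x \<in> weyl R"
  shows "inv (sref e \<circ> x) e \<in> Rp \<longleftrightarrow> inv x e \<notin> Rp"
  unfolding inv_reflect[OF assms] by (rule neg_Rp[OF inv_root[OF assms(2) wall_R[OF assms(1)]]])

lemma wall_stay:
  assumes "wall e" "edge x b" "inv x e \<in> Rp" "inv x e \<noteq> b"
  shows "sref b (inv x e) \<in> Rp"
  using wall_crossing[OF assms(1-3)] assms(4) by blast

text \<open>Separates a reflected tail, which stays on the negative side throughout, from a path
  that still contains an inserted crossing. This makes the place of an insertion
  recoverable.\<close>

fun all_neg :: "'a \<Rightarrow> ('a \<Rightarrow> 'a) \<Rightarrow> 'a list \<Rightarrow> bool" where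
  "all_neg e x [] \<longleftrightarrow> inv x e \<notin> Rp"
| "all_neg e x (b # gs) \<longleftrightarrow> inv x e \<notin> Rp \<and> all_neg e (x \<circ> sref b) gs"

text \<open>The next label \<open>b\<close> comes after \<open>inv x e\<close>, so it is not the
  crossing and the path stays positive. By \<open>lt_sref\<close> the new root still precedes
  \<open>b\<close> and hence all later labels, so the path can be reflected edge by edge.\<close>

lemma path_reflect:
  assumes w: "wall e"
  shows "path x gs y \<Longrightarrow> inv x e \<in> Rp \<Longrightarrow> \<forall>g\<in>set gs. lt (inv x e) g
    \<Longrightarrow> path (sref e \<circ> x) gs (sref e \<circ> y) \<and> inv y e \<in> Rp \<and> all_neg e (sref e \<circ> x) gs"
proof (induction gs arbitrary: x)
  case Nil
  then have x: "x \<in> weyl R" "y = x" by auto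
  show ?case
    using left_weyl[OF x(1) wall_R[OF w]] inv_reflect_Rp[OF w x(1)] Nil.prems(2)
    unfolding x(2) qbg_path.simps all_neg.simps sorted_wrt.simps(1) by blast
next
  case (Cons b gs)
  have ed: "edge x b" and p: "path (x \<circ> sref b) gs y" and bg: "\<forall>g\<in>set gs. lt b g"
    using Cons.prems(1) unfolding path_Cons by auto
  have x: "x \<in> weyl R" and b: "b \<in> Rp" using ed by (auto simp: edge_iff)
  have l: "lt (inv x e) b" using Cons.prems(3) by simp
  then have ne: "inv x e \<noteq> b" using lt_irrefl[OF b] by auto
  have s: "sref b (inv x e) \<in> Rp" using wall_stay[OF w ed Cons.prems(2) ne] .
  have "lt (sref b (inv x e)) b" using lt_sref[OF Cons.prems(2) b ne s] l by simp
  then have "\<forall>g\<in>set gs. lt (sref b (inv x e)) g"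
    using bg lt_trans[OF s b] path_Rp[OF p] by blast
  then have IH: "path (sref e \<circ> (x \<circ> sref b)) gs (sref e \<circ> y) \<and> inv y e \<in> Rp \<and> all_neg e (sref e \<circ> (x \<circ> sref b)) gs"
    using Cons.IH[OF p] s unfolding inv_step[OF ed] by blast
  have "edge (sref e \<circ> x) b" using wall_reflect[OF w ed] Cons.prems(2) s by blast
  moreover have "inv (sref e \<circ> x) e \<notin> Rp" using inv_reflect_Rp[OF w x] Cons.prems(2) by simp
  ultimately show ?case using IH bg unfolding path_Cons all_neg.simps comp_assoc by blast
qed

section \<open>Inserting a crossing\<close>

text \<open>The crossing goes in front of the first label that exceeds the current
  \<open>inv x e\<close>. The labels behind it are kept, but now belong to the path reflected in the
  wall.\<close>

fun insert_crossing :: "'a \<Rightarrow> ('a \<Rightarrow> 'a) \<Rightarrow> 'a list \<Rightarrow> 'a list" where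
  "insert_crossing e x [] = [inv x e]"
| "insert_crossing e x (b # gs) = (if inv x e \<in> Rp \<and> lt (inv x e) b then inv x e # b # gs
     else b # insert_crossing e (x \<circ> sref b) gs)"

text \<open>\<open>U\<close> is the set of labels that may still be used: a positive root \<open>x\<^bsup>-1\<^esup> e\<close> must still be
  ahead, a negative one must have been passed.  In that state the insertion place is unique.\<close>

definition ready :: "'a \<Rightarrow> 'a set \<Rightarrow> ('a \<Rightarrow> 'a) \<Rightarrow> 'a list \<Rightarrow> ('a \<Rightarrow> 'a) \<Rightarrow> bool" where
  "ready e U x gs y \<longleftrightarrow> path x gs y \<and> inv y e \<in> Rp \<and> set gs \<subseteq> U
     \<and> (\<forall>a\<in>U. \<forall>b\<in>Rp. lt a b \<longrightarrow> b \<in> U) \<and> U \<subseteq> Rp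
     \<and> (if inv x e \<in> Rp then inv x e \<in> U else - inv x e \<notin> U)"

text \<open>A positive \<open>inv x e\<close> other than \<open>b\<close> lies after
  \<open>b\<close> and stays there by \<open>lt_sref\<close>; the value \<open>b\<close> itself
  turns into \<open>- b\<close> and counts as passed. A negative one has \<open>- inv x e\<close>
  before \<open>b\<close>: if it stays negative, it stays passed; if it becomes positive,
  \<open>lt_sref_neg\<close> puts it after \<open>b\<close>, so that it can still be
  crossed.\<close>

lemma ready_step:
  assumes w: "wall e" and r: "ready e U x (b # gs) y" and n: "\<not> (inv x e \<in> Rp \<and> lt (inv x e) b)"
  shows "ready e {g\<in>Rp. lt b g} (x \<circ> sref b) gs y"
proof -
  let ?d = "inv x e"
  have ed: "edge x b" and p: "path (x \<circ> sref b) gs y" and bg: "\<forall>g\<in>set gs. lt b g" and y: "inv y e \<in> Rp"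
    and bU: "b \<in> U" and up: "\<And>a c. a \<in> U \<Longrightarrow> c \<in> Rp \<Longrightarrow> lt a c \<Longrightarrow> c \<in> U"
    and dU: "if ?d \<in> Rp then ?d \<in> U else - ?d \<notin> U"
    using r unfolding ready_def path_Cons by auto
  have x: "x \<in> weyl R" and b: "b \<in> Rp" using ed by (auto simp: edge_iff)
  have dR: "?d \<in> R" using inv_root[OF x wall_R[OF w]] .
  have "if sref b ?d \<in> Rp then lt b (sref b ?d) else \<not> lt b (- sref b ?d)"
  proof (cases "?d \<in> Rp")
    case True
    show ?thesis
    proof (cases "?d = b")
      case True
      then show ?thesis using sref_self[OF Rp_nz[OF b]] notin_neg[OF b] lt_irrefl[OF b] by simp
    next
      case False
      then have "lt b ?d" using n True lt_total[OF True b] by blast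
      moreover have s: "sref b ?d \<in> Rp" using wall_stay[OF w ed True False] .
      moreover have "sref b ?d \<noteq> b"
        using sref_sref[OF Rp_nz[OF b], of ?d] sref_self[OF Rp_nz[OF b]] notin_neg[OF b] True by metis
      ultimately show ?thesis
        using lt_sref[OF True b False s] lt_total[OF s b] lt_asym[OF b True] by auto
    qed
  next
    case False
    then have m: "- ?d \<in> Rp" and mU: "- ?d \<notin> U" using neg_Rp[OF dR] dU by auto
    have ne: "- ?d \<noteq> b" using mU bU by auto
    have l: "lt (- ?d) b" using lt_total[OF m b ne] up[OF bU m] mU by blast
    show ?thesis
    proof (cases "sref b ?d \<in> Rp")
      case True
      then have "sref b (- ?d) \<notin> Rp" using notin_neg by (simp add: sref_minus_arg)
      then show ?thesis using lt_sref_neg[OF m b ne _ l] True by (simp add: sref_minus_arg)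
    next
      case False
      then have s: "sref b (- ?d) \<in> Rp" using neg_Rp[OF sref_root[OF Rp_R[OF b] dR]] by (simp add: sref_minus_arg)
      then have "lt (sref b (- ?d)) b" using lt_sref[OF m b ne s] l by simp
      then have "\<not> lt b (sref b (- ?d))" using lt_asym[OF s b] by blast
      then show ?thesis using False by (simp add: sref_minus_arg)
    qed
  qed
  moreover have "- sref b ?d \<in> Rp" if "sref b ?d \<notin> Rp"
    using that neg_Rp[OF sref_root[OF Rp_R[OF b] dR]] by simp
  moreover have "set gs \<subseteq> {g\<in>Rp. lt b g}" using bg path_Rp[OF p] by blast
  moreover have "\<forall>a\<in>{g\<in>Rp. lt b g}. \<forall>c\<in>Rp. lt a c \<longrightarrow> c \<in> {g\<in>Rp. lt b g}"
    using lt_trans[OF b] by blast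
  ultimately show ?thesis
    using p y unfolding ready_def inv_step[OF ed] by auto
qed

lemma insert_crossing_path:
  assumes w: "wall e"
  shows "ready e U x gs y \<Longrightarrow>
    path x (insert_crossing e x gs) (sref e \<circ> y) \<and> set (insert_crossing e x gs) \<subseteq> U \<and> \<not> all_neg e x (insert_crossing e x gs)"
proof (induction gs arbitrary: x U)
  case Nil
  \<comment> \<open>The start is also the end here, hence positive, so readiness puts the label of
    the crossing into \<open>U\<close>.\<close>
  then have x: "x \<in> weyl R" "y = x" and d: "inv x e \<in> Rp" "inv x e \<in> U" by (auto simp: ready_def)
  have "path x [inv x e] (sref e \<circ> y)"
    using wall_jump[OF w x(1) d(1)] left_weyl[OF x(1) wall_R[OF w]]
    unfolding x(2) left_eq_right[OF x(1), of e] qbg_path.simps sorted_wrt1 by blast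
  moreover have "set (insert_crossing e x []) \<subseteq> U \<and> \<not> all_neg e x (insert_crossing e x [])" using d by simp
  ultimately show ?case unfolding insert_crossing.simps by blast
next
  case (Cons b gs)
  let ?d = "inv x e"
  have p: "path x (b # gs) y" and bU: "set (b # gs) \<subseteq> U" and up: "\<And>a c. a \<in> U \<Longrightarrow> c \<in> Rp \<Longrightarrow> lt a c \<Longrightarrow> c \<in> U"
    and dU: "?d \<in> Rp \<Longrightarrow> ?d \<in> U"
    using Cons.prems unfolding ready_def by auto
  have x: "x \<in> weyl R" using path_weyl[OF p] .
  have bR: "b \<in> Rp" "set gs \<subseteq> Rp" using path_Rp[OF p] by auto
  show ?case
  proof (cases "?d \<in> Rp \<and> lt ?d b")
    case True
    then have l: "\<forall>g\<in>set (b # gs). lt ?d g"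
      using p lt_trans[of ?d b] bR unfolding path_Cons by auto
    then have "path (sref e \<circ> x) (b # gs) (sref e \<circ> y)" using path_reflect[OF w p] True by blast
    then have "path x (?d # b # gs) (sref e \<circ> y)"
      using wall_jump[OF w x] True l path_Cons[of x ?d "b # gs"] unfolding left_eq_right[OF x, of e] by blast
    moreover have "set (?d # b # gs) \<subseteq> U" "\<not> all_neg e x (?d # b # gs)" using True dU bU by auto
    moreover have "insert_crossing e x (b # gs) = ?d # b # gs" using True by simp
    ultimately show ?thesis by metis
  next
    case False
    have r: "ready e {g\<in>Rp. lt b g} (x \<circ> sref b) gs y" by (rule ready_step[OF w Cons.prems False])
    from Cons.IH[OF this]
    have IH: "path (x \<circ> sref b) (insert_crossing e (x \<circ> sref b) gs) (sref e \<circ> y)"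
      "set (insert_crossing e (x \<circ> sref b) gs) \<subseteq> {g\<in>Rp. lt b g}" "\<not> all_neg e (x \<circ> sref b) (insert_crossing e (x \<circ> sref b) gs)" by blast+
    have eq: "insert_crossing e x (b # gs) = b # insert_crossing e (x \<circ> sref b) gs" using False by auto
    have "edge x b" using p by simp
    then have "path x (insert_crossing e x (b # gs)) (sref e \<circ> y)" using IH unfolding eq path_Cons by blast
    moreover have "set (insert_crossing e x (b # gs)) \<subseteq> U" using IH(2) bU up unfolding eq by auto
    moreover have "\<not> all_neg e x (insert_crossing e x (b # gs))" using IH(3) unfolding eq by simp
    ultimately show ?thesis by blast
  qed
qed

lemma insert_crossing_ne: "insert_crossing e x gs \<noteq> []"
  by (cases gs) auto

text \<open>If the results agreed, the second list would start with the crossing as an ordinary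
  label \<open>c\<close>. Its remainder contains a further, inserted crossing, while the remainder
  of the first list stays on the negative side.\<close>

lemma insert_crossing_inj_aux:
  assumes w: "wall e" and r: "ready e U x (b # gs) y" "ready e U x (c # hs) y"
    and l: "inv x e \<in> Rp" "lt (inv x e) b" "\<not> lt (inv x e) c"
  shows "insert_crossing e x (b # gs) \<noteq> insert_crossing e x (c # hs)"
proof
  assume eq: "insert_crossing e x (b # gs) = insert_crossing e x (c # hs)"
  have p: "path x (b # gs) y" using r(1) by (simp add: ready_def)
  have x: "x \<in> weyl R" using path_weyl[OF p] .
  have c: "c = inv x e" and gs: "b # gs = insert_crossing e (x \<circ> sref c) hs" using eq l by auto
  have bR: "b \<in> Rp" "set gs \<subseteq> Rp" using path_Rp[OF p] by auto
  have "\<forall>g\<in>set (b # gs). lt (inv x e) g"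
    using p l lt_trans[of "inv x e" b] bR unfolding path_Cons by auto
  then have "all_neg e (sref e \<circ> x) (b # gs)" using path_reflect[OF w p l(1)] by blast
  moreover have "\<not> all_neg e (x \<circ> sref c) (insert_crossing e (x \<circ> sref c) hs)"
    using insert_crossing_path[OF w ready_step[OF w r(2)]] l by blast
  ultimately show False unfolding left_eq_right[OF x, of e] c[symmetric] gs by blast
qed

lemma insert_crossing_inj:
  assumes w: "wall e"
  shows "ready e U x gs y \<Longrightarrow> ready e U x hs y \<Longrightarrow> insert_crossing e x gs = insert_crossing e x hs \<Longrightarrow> gs = hs"
proof (induction gs arbitrary: x U hs)
  case Nil
  show ?case
  proof (cases hs)
    case (Cons c hs')
    then show ?thesis using Nil.prems(3) insert_crossing_ne[of e "x \<circ> sref c" hs'] by (auto split: if_splits)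
  qed simp
next
  case (Cons b gs)
  show ?case
  proof (cases hs)
    case Nil
    then show ?thesis using Cons.prems(3) insert_crossing_ne[of e "x \<circ> sref b" gs] by (auto split: if_splits)
  next
    case hs: (Cons c hs')
    let ?A = "\<lambda>b. inv x e \<in> Rp \<and> lt (inv x e) b"
    have "?A b \<longleftrightarrow> ?A c"
      using insert_crossing_inj_aux[OF w, of U x b gs y c hs'] insert_crossing_inj_aux[OF w, of U x c hs' y b gs] Cons.prems
      unfolding hs by metis
    then consider "?A b" "?A c" | "\<not> ?A b" "\<not> ?A c" by blast
    then show ?thesis
    proof cases
      case 1
      then show ?thesis using Cons.prems(3) unfolding hs by simp
    next
      case 2
      then have eq: "b = c" "insert_crossing e (x \<circ> sref b) gs = insert_crossing e (x \<circ> sref b) hs'"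
        using Cons.prems(3) unfolding hs by auto
      then have "gs = hs'"
        using Cons.IH ready_step[OF w Cons.prems(1) 2(1)] ready_step[OF w Cons.prems(2)[unfolded hs] 2(2)]
        by blast
      then show ?thesis using eq hs by simp
    qed
  qed
qed

section \<open>Deleting the first crossing\<close>

fun delete_crossing :: "'a \<Rightarrow> ('a \<Rightarrow> 'a) \<Rightarrow> 'a list \<Rightarrow> 'a list" where
  "delete_crossing e x [] = []"
| "delete_crossing e x (b # gs) = (if b = inv x e then gs else b # delete_crossing e (x \<circ> sref b) gs)"

text \<open>Up to the first crossing the path is reflected in the wall. The crossing leads from its
  vertex \<open>z\<close> to \<open>sref e \<circ> z\<close>, where the reflected path already is,
  so the remaining labels apply unchanged.\<close>

lemma delete_crossing_path:
  assumes w: "wall e" and y: "inv y e \<notin> Rp"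
  shows "path x gs y \<Longrightarrow> inv x e \<in> Rp \<Longrightarrow> path (sref e \<circ> x) (delete_crossing e x gs) y \<and> set (delete_crossing e x gs) \<subseteq> set gs"
proof (induction gs arbitrary: x)
  case Nil
  then show ?case using y by simp
next
  case (Cons b gs)
  have ed: "edge x b" and p: "path (x \<circ> sref b) gs y" and bg: "\<forall>g\<in>set gs. lt b g"
    using Cons.prems(1) unfolding path_Cons by auto
  have x: "x \<in> weyl R" and b: "b \<in> Rp" using ed by (auto simp: edge_iff)
  show ?case
  proof (cases "b = inv x e")
    case True
    then have "delete_crossing e x (b # gs) = gs" "sref e \<circ> x = x \<circ> sref b"
      using left_eq_right[OF x, of e] by simp_all
    then show ?thesis using p by (simp only:) auto
  next
    case False
    have s: "sref b (inv x e) \<in> Rp" using wall_stay[OF w ed Cons.prems(2)] False by blast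
    have IH: "path (sref e \<circ> (x \<circ> sref b)) (delete_crossing e (x \<circ> sref b) gs) y" "set (delete_crossing e (x \<circ> sref b) gs) \<subseteq> set gs"
      using Cons.IH[OF p] s unfolding inv_step[OF ed] by blast+
    have "edge (sref e \<circ> x) b" using wall_reflect[OF w ed] Cons.prems(2) s by blast
    moreover have eq: "delete_crossing e x (b # gs) = b # delete_crossing e (x \<circ> sref b) gs" using False by simp
    ultimately have "path (sref e \<circ> x) (delete_crossing e x (b # gs)) y"
      using IH bg unfolding eq path_Cons comp_assoc by blast
    moreover have "set (delete_crossing e x (b # gs)) \<subseteq> set (b # gs)" using IH(2) unfolding eq by auto
    ultimately show ?thesis by blast
  qed
qed

text \<open>Equal results make \<open>c\<close> the label that follows the crossing in the first
  path, so \<open>inv x e\<close> precedes every label of the second. By \<open>path_reflect\<close>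
  the second path then never crosses, although its end is negative.\<close>

lemma delete_crossing_inj_aux:
  assumes w: "wall e" and y: "inv y e \<notin> Rp" and x: "inv x e \<in> Rp"
    and p: "path x (b # gs) y" "path x (c # hs) y" and bc: "b = inv x e" "c \<noteq> inv x e"
  shows "delete_crossing e x (b # gs) \<noteq> delete_crossing e x (c # hs)"
proof
  assume "delete_crossing e x (b # gs) = delete_crossing e x (c # hs)"
  then have gs: "gs = c # delete_crossing e (x \<circ> sref c) hs" using bc by simp
  have cR: "c \<in> Rp" "set hs \<subseteq> Rp" using path_Rp[OF p(2)] by auto
  have "lt (inv x e) c" using p(1) bc unfolding gs by simp
  then have "\<forall>g\<in>set (c # hs). lt (inv x e) g"
    using p(2) lt_trans[OF x cR(1)] cR(2) unfolding path_Cons by auto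
  then show False using path_reflect[OF w p(2) x] y by blast
qed

lemma delete_crossing_inj:
  assumes w: "wall e" and y: "inv y e \<notin> Rp"
  shows "path x gs y \<Longrightarrow> path x hs y \<Longrightarrow> inv x e \<in> Rp \<Longrightarrow> delete_crossing e x gs = delete_crossing e x hs \<Longrightarrow> gs = hs"
proof (induction gs arbitrary: x hs)
  case Nil
  then show ?case using y by auto
next
  case (Cons b gs)
  show ?case
  proof (cases hs)
    case Nil
    then show ?thesis using Cons.prems y by auto
  next
    case hs: (Cons c hs')
    let ?d = "inv x e"
    have "b = ?d \<longleftrightarrow> c = ?d"
      using delete_crossing_inj_aux[OF w y Cons.prems(3), of b gs c hs'] delete_crossing_inj_aux[OF w y Cons.prems(3), of c hs' b gs]
        Cons.prems unfolding hs by metis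
    then consider "b = ?d" "c = ?d" | "b \<noteq> ?d" "c \<noteq> ?d" by blast
    then show ?thesis
    proof cases
      case 1
      then show ?thesis using Cons.prems(4) unfolding hs by simp
    next
      case 2
      then have eq: "b = c" "delete_crossing e (x \<circ> sref b) gs = delete_crossing e (x \<circ> sref b) hs'"
        using Cons.prems(4) unfolding hs by auto
      have ed: "edge x b" and p: "path (x \<circ> sref b) gs y" using Cons.prems(1) unfolding path_Cons by auto
      have p': "path (x \<circ> sref b) hs' y" using Cons.prems(2) eq(1) unfolding hs path_Cons by auto
      have "inv (x \<circ> sref b) e \<in> Rp"
        using wall_stay[OF w ed Cons.prems(3)] 2 unfolding inv_step[OF ed] by blast
      then have "gs = hs'" using Cons.IH[OF p p' _ eq(2)] by blast
      then show ?thesis using eq hs by simp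
    qed
  qed
qed

definition uniq :: "('a \<Rightarrow> 'a) \<Rightarrow> bool" where
  "uniq x \<longleftrightarrow> (\<forall>y gs hs. path x gs y \<longrightarrow> path x hs y \<longrightarrow> gs = hs)"

lemma path_ready:
  assumes "path x gs y" "inv x e \<in> Rp" "inv y e \<in> Rp"
  shows "ready e Rp x gs y"
  using assms path_Rp[OF assms(1)] by (simp add: ready_def)

text \<open>For a positive end, insertion first moves the end to the negative side and fixes the
  start; deletion then moves the start.\<close>

lemma uniq_backward:
  assumes w: "wall e" and x: "inv x e \<in> Rp" and u: "uniq (sref e \<circ> x)"
  shows "uniq x"
proof -
  have neg: "gs = hs" if "path x gs y" "path x hs y" "inv y e \<notin> Rp" for gs hs y
    using delete_crossing_inj[OF w that(3,1,2) x] delete_crossing_path[OF w that(3,1) x] delete_crossing_path[OF w that(3,2) x] u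
    unfolding uniq_def by blast
  have "gs = hs" if "path x gs y" "path x hs y" for gs hs y
  proof (cases "inv y e \<in> Rp")
    case True
    note r = path_ready[OF that(1) x True] path_ready[OF that(2) x True]
    have "inv (sref e \<circ> y) e \<notin> Rp"
      using inv_reflect_Rp[OF w path_end_weyl[OF that(1)]] True by blast
    then have "insert_crossing e x gs = insert_crossing e x hs" using neg insert_crossing_path[OF w r(1)] insert_crossing_path[OF w r(2)] by blast
    then show ?thesis using insert_crossing_inj[OF w r] by blast
  next
    case False
    then show ?thesis using neg that by blast
  qed
  then show ?thesis unfolding uniq_def by blast
qed

end

section \<open>Uniqueness of monotone paths\<close>


lemma sorted_wrt_irrefl_distinct:
  "sorted_wrt r xs \<Longrightarrow> \<forall>a\<in>set xs. \<not> r a a \<Longrightarrow> distinct xs"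
  by (induction xs) auto

lemma sorted_wrt_eqI:
  "\<lbrakk>\<And>a b. a \<in> set xs \<Longrightarrow> b \<in> set xs \<Longrightarrow> r a b \<Longrightarrow> \<not> r b a; sorted_wrt r xs; sorted_wrt r ys; set xs = set ys\<rbrakk>
    \<Longrightarrow> xs = ys"
proof (induction xs arbitrary: ys)
  case Nil
  then show ?case by simp
next
  case (Cons a xs)
  obtain b ys' where ys: "ys = b # ys'" using Cons.prems(4) by (cases ys) auto
  have irr: "\<not> r c c" if "c \<in> set (a # xs)" for c using Cons.prems(1)[OF that that] by blast
  have ab: "a = b"
  proof (rule ccontr)
    assume "a \<noteq> b"
    then have "b \<in> set xs" "a \<in> set ys'" using Cons.prems(4) ys by auto
    then have "r a b" "r b a" using Cons.prems(2,3) ys by auto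
    then show False using Cons.prems(1)[of a b] \<open>b \<in> set xs\<close> by simp
  qed
  have "a \<notin> set xs" "a \<notin> set ys'"
    using Cons.prems(2,3) irr[of a] ys ab by auto
  then have "set xs = set ys'" using Cons.prems(4) ys ab by auto
  moreover have "\<And>c d. c \<in> set xs \<Longrightarrow> d \<in> set xs \<Longrightarrow> r c d \<Longrightarrow> \<not> r d c"
    using Cons.prems(1) by (meson list.set_intros(2))
  ultimately have "xs = ys'" using Cons.IH[of ys'] Cons.prems(2,3) ys by auto
  then show ?case using ys ab by simp
qed

context root_sys
begin

lemma inner_inv:
  assumes "x \<in> weyl R"
  shows "inv x a \<bullet> b = a \<bullet> x b"
proof -
  have "x (inv x a) \<bullet> x b = inv x a \<bullet> b"
    using orthogonal_weyl[OF assms] unfolding orthogonal_transformation_def by blast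
  then show ?thesis unfolding weyl_inv[OF assms] by simp
qed

text \<open>Expresses the sign by the side of the hyperplane of \<open>a\<close> on which
  \<open>x v\<close> lies, so that orbit points can be summed later.\<close>

lemma inv_Rp_iff:
  assumes "x \<in> weyl R" "a \<in> R"
  shows "inv x a \<in> Rp \<longleftrightarrow> a \<bullet> x v > 0"
  using Rp_iff[OF inv_root[OF assms]] unfolding inner_inv[OF assms(1)] .

lemma invs_le: "invs x \<le> card Rp"
  unfolding invs_def by (rule card_mono[OF finRp]) blast

lemma invs_max:
  assumes y: "y \<in> weyl R" and neg: "\<And>e. e \<in> simple_roots Rp \<Longrightarrow> inv y e \<notin> Rp"
  shows "invs y = card Rp"
proof -
  have "(- y v) \<bullet> e \<ge> 0" if "e \<in> simple_roots Rp" for e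
    using neg[OF that] inv_Rp_iff[OF y simple_R[OF that]] by (simp add: inner_commute not_less)
  then have nn: "(- y v) \<bullet> a \<ge> 0" if "a \<in> Rp" for a using nonneg_on_simple that by blast
  have "y a \<notin> Rp" if a: "a \<in> Rp" for a
  proof
    assume ya: "y a \<in> Rp"
    have "inv y (y a) \<in> Rp" using a inv_weyl[OF y] by simp
    then show False using nn[OF ya] inv_Rp_iff[OF y Rp_R[OF ya]] by (simp add: inner_commute)
  qed
  then show ?thesis unfolding invs_def by (metis (mono_tags, lifting) Collect_cong Collect_mem_eq)
qed

end

context refl_order
begin

lemma path_length: "path x gs y \<Longrightarrow> invs y \<le> invs x + length gs"
proof (induction gs arbitrary: x)
  case Nil
  then show ?case by simp
next
  case (Cons b gs)
  then have "edge x b" "path (x \<circ> sref b) gs y" by auto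
  then show ?case using Cons.IH edge_invs_le by fastforce
qed

text \<open>Labels of a sorted path are distinct and each edge raises the length by at most one, so
  climbing from 0 to \<open>card Rp\<close> uses up all positive roots.\<close>

lemma path_full:
  assumes "path id gs y" "invs y = card Rp"
  shows "set gs = Rp"
proof (rule card_subset_eq[OF finRp path_Rp[OF assms(1)]])
  have "distinct gs" using sorted_wrt_irrefl_distinct[of lt gs] path_Rp[OF assms(1)] lt_irrefl assms(1) by blast
  then have "card (set gs) = length gs" by (rule distinct_card)
  moreover have "invs id = 0" by (simp add: invs_def)
  ultimately have "card Rp \<le> card (set gs)" using path_length[OF assms(1)] assms(2) by simp
  then show "card (set gs) = card Rp"
    using card_mono[OF finRp path_Rp[OF assms(1)]] by simp
qed

text \<open>Each inserted simple crossing raises the end by one and leaves the start at the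
  identity. Once no simple wall is positive at the end, the set of labels is known and sorting
  determines the path.\<close>

lemma uniq_id: "uniq id"
proof -
  have "gs = hs" if "path id gs y" "path id hs y" for gs hs y
    using that
  proof (induction "card Rp - invs y" arbitrary: y gs hs rule: less_induct)
    case less
    have y: "y \<in> weyl R" using path_end_weyl[OF less.prems(1)] .
    show ?case
    proof (cases "\<exists>e\<in>simple_roots Rp. inv y e \<in> Rp")
      case True
      then obtain e where e: "e \<in> simple_roots Rp" "inv y e \<in> Rp" by blast
      then have w: "wall e" by (simp add: wall_def)
      have "inv id e \<in> Rp" using simple_Rp[OF e(1)] by simp
      note r = path_ready[OF less.prems(1) this e(2)] path_ready[OF less.prems(2) this e(2)]
      have up: "invs (sref e \<circ> y) = invs y + 1" using invs_left_up[OF e(1) y e(2)] .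
      then have "card Rp - invs (sref e \<circ> y) < card Rp - invs y" using invs_le[of "sref e \<circ> y"] by linarith
      then have "insert_crossing e id gs = insert_crossing e id hs"
        using less.hyps insert_crossing_path[OF w r(1)] insert_crossing_path[OF w r(2)] by blast
      then show ?thesis using insert_crossing_inj[OF w r] by blast
    next
      case False
      then have full: "invs y = card Rp" using invs_max[OF y] by blast
      have "set gs = Rp" "set hs = Rp" using path_full less.prems full by blast+
      then show ?thesis using sorted_wrt_eqI[of gs lt hs] lt_asym less.prems by blast
    qed
  qed
  then show ?thesis unfolding uniq_def by blast
qed

section \<open>Positive crossings as a flow on the Weyl group\<close>

lemma finite_weyl: "finite (weyl R)"
proof -
  have "inj_on (\<lambda>x. restrict x R) (weyl R)"
  proof (rule inj_onI)
    fix x y assume x: "x \<in> weyl R" and y: "y \<in> weyl R" and eq: "restrict x R = restrict y R"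
    have "x a = y a" if "a \<in> R" for a using fun_cong[OF eq, of a] that by simp
    then have "x z = y z" for z
      using linear_eq_on_span[OF linear_weyl[OF x] linear_weyl[OF y], of R] span_R by blast
    then show "x = y" by blast
  qed
  moreover have "(\<lambda>x. restrict x R) ` weyl R \<subseteq> R \<rightarrow>\<^sub>E R" using weyl_root by auto
  then have "finite ((\<lambda>x. restrict x R) ` weyl R)"
    using finite_subset finite_PiE[OF finR, of "\<lambda>_. R"] finR by blast
  ultimately show ?thesis by (rule finite_imageD[rotated])
qed

lemma reflect_inner:
  assumes "e \<in> R"
  shows "e \<bullet> (sref e \<circ> x) z = - (e \<bullet> x z)"
proof -
  have "sref e e \<bullet> sref e (x z) = e \<bullet> x z"
    using orthogonal_sref[of e] unfolding orthogonal_transformation_def by blast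
  then show ?thesis by (simp add: sref_self[OF root_nz[OF assms]])
qed

text \<open>Summing the points \<open>x v\<close> over a set \<open>B\<close> that is closed under positive wall crossings gives
  a vector on the nonpositive side of all walls, the affine ones included; since a positive
  combination of the walls vanishes, it lies on all of them.\<close>

lemma closed_sum:
  assumes B: "B \<subseteq> weyl R" and e: "e \<in> R"
    and cl: "\<And>x. x \<in> B \<Longrightarrow> inv x e \<in> Rp \<Longrightarrow> sref e \<circ> x \<in> B"
  shows "e \<bullet> (\<Sum>x\<in>B. x v) \<le> 0"
    and "e \<bullet> (\<Sum>x\<in>B. x v) = 0 \<Longrightarrow> x \<in> B \<Longrightarrow> sref e \<circ> x \<in> B"
proof -
  define P where "P = {x\<in>B. inv x e \<in> Rp}"
  \<comment> \<open>\<open>S\<close> is the mirror image of \<open>P\<close>; it lies in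
    \<open>B\<close> by closedness and cancels \<open>P\<close> in the sum. There remain negative
    points whose mirror images are missing from \<open>B\<close>, and a zero sum means that there
    are none.\<close>
  define S where "S = (\<lambda>x. sref e \<circ> x) ` P"
  have finB: "finite B" using B finite_weyl finite_subset by blast
  have inj: "inj_on (\<lambda>x. sref e \<circ> x) P"
    by (rule inj_on_inverseI[of _ "\<lambda>x. sref e \<circ> x"]) (rule left_left[OF e])
  have sgn: "inv x e \<in> Rp \<longleftrightarrow> e \<bullet> x v > 0" "e \<bullet> x v \<noteq> 0" if "x \<in> B" for x
    using inv_Rp_iff[of x e] v_nonzero[OF inv_root[of x e]] inner_inv[of x e v] B that e by auto
  have SB: "S \<subseteq> B - P"
  proof
    fix z assume "z \<in> S"
    then obtain x where x: "x \<in> P" "z = sref e \<circ> x" by (auto simp: S_def)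
    then have xB: "x \<in> B" "e \<bullet> x v > 0" using sgn[of x] by (auto simp: P_def)
    have zB: "z \<in> B" using cl x by (auto simp: P_def)
    moreover have "e \<bullet> z v < 0" using xB reflect_inner[OF e, of x v] x by simp
    ultimately show "z \<in> B - P" using sgn[of z] by (auto simp: P_def)
  qed
  have "(\<Sum>x\<in>S. e \<bullet> x v) = (\<Sum>x\<in>P. e \<bullet> (sref e \<circ> x) v)"
    unfolding S_def by (rule sum.reindex_cong[OF inj refl refl])
  then have S: "(\<Sum>x\<in>S. e \<bullet> x v) = - (\<Sum>x\<in>P. e \<bullet> x v)"
    unfolding reflect_inner[OF e] sum_negf .
  have split: "e \<bullet> (\<Sum>x\<in>B. x v) = (\<Sum>x\<in>B - P - S. e \<bullet> x v)"
  proof -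
    have "(\<Sum>x\<in>B. e \<bullet> x v) = (\<Sum>x\<in>B - P. e \<bullet> x v) + (\<Sum>x\<in>P. e \<bullet> x v)"
      by (rule sum.subset_diff[OF _ finB]) (auto simp: P_def)
    moreover have "(\<Sum>x\<in>B - P. e \<bullet> x v) = (\<Sum>x\<in>B - P - S. e \<bullet> x v) + (\<Sum>x\<in>S. e \<bullet> x v)"
      by (rule sum.subset_diff[OF SB]) (simp add: finB)
    ultimately show ?thesis using S by (simp add: inner_sum_right)
  qed
  have neg: "e \<bullet> x v < 0" if "x \<in> B - P - S" for x
    using that sgn[of x] by (auto simp: P_def)
  show le: "e \<bullet> (\<Sum>x\<in>B. x v) \<le> 0"
    unfolding split by (rule sum_nonpos) (use neg less_imp_le in blast)
  assume 0: "e \<bullet> (\<Sum>x\<in>B. x v) = 0" and x: "x \<in> B"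
  have "B - P - S = {}"
  proof (rule ccontr)
    assume "B - P - S \<noteq> {}"
    then have "(\<Sum>x\<in>B - P - S. e \<bullet> x v) < (\<Sum>x\<in>B - P - S. 0)"
      by (intro sum_strict_mono) (use neg finB in auto)
    then show False using 0 split by simp
  qed
  show "sref e \<circ> x \<in> B"
  proof (cases "x \<in> P")
    case True
    then show ?thesis using cl by (auto simp: P_def)
  next
    case False
    then have "x \<in> S" using x \<open>B - P - S = {}\<close> by blast
    then obtain z where "z \<in> P" "x = sref e \<circ> z" by (auto simp: S_def)
    then show ?thesis using left_left[OF e, of z] by (auto simp: P_def)
  qed
qed

text \<open>Reachability of the identity in contrapositive form. It is applied to the set of
  vertices without uniqueness, which by \<open>uniq_backward\<close> no positive crossing can leave;
  no sequence of crossings is constructed.\<close>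

lemma wall_closed_id:
  assumes B: "B \<subseteq> weyl R" "B \<noteq> {}"
    and cl: "\<And>x e. x \<in> B \<Longrightarrow> wall e \<Longrightarrow> inv x e \<in> Rp \<Longrightarrow> sref e \<circ> x \<in> B"
  shows "id \<in> B"
proof -
  define f where "f = (\<Sum>x\<in>B. x v)"
  have le: "f \<bullet> e \<le> 0" if "wall e" for e
    using closed_sum(1)[OF B(1) wall_R[OF that]] cl that unfolding f_def inner_commute[of e] by blast
  have "(- f) \<bullet> e \<ge> 0" if "e \<in> simple_roots Rp" for e
    using le[of e] that by (simp add: wall_def)
  then have neg: "f \<bullet> a \<le> 0" if "a \<in> Rp" for a
    using nonneg_on_simple[of "- f" a] that by simp
  \<comment> \<open>\<open>f\<close> is nonnegative on maximal roots; going down,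
    \<open>f \<bullet> a = f \<bullet> (a + b) - f \<bullet> b\<close> stays nonnegative. This
    replaces writing a maximal root as a positive combination of simple ones.\<close>
  have pos: "f \<bullet> a \<ge> 0" if "a \<in> Rp" for a
    using that
  proof (induction a rule: Rp_induct_down)
    case (greater a)
    show ?case
    proof (cases "top_root a")
      case True
      then show ?thesis using le[of "- a"] by (simp add: wall_def)
    next
      case False
      then obtain b where b: "b \<in> Rp" "a + b \<in> R" using greater.hyps by (auto simp: top_root_def)
      have "(a + b) \<bullet> v > a \<bullet> v" using Rp_pos[OF b(1)] by (simp add: inner_add_left)
      moreover from this have "a + b \<in> Rp" using Rp_pos[OF greater.hyps] Rp_iff[OF b(2)] by simp
      ultimately have "f \<bullet> (a + b) \<ge> 0" using greater.IH by blast
      then show ?thesis using neg[OF b(1)] by (simp add: inner_add_right)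
    qed
  qed
  \<comment> \<open>Now \<open>f\<close> vanishes on all positive roots, and the equality case of
    \<open>closed_sum\<close> gives closure under simple reflections in both directions.\<close>
  have cls: "sref e \<circ> x \<in> B" if "e \<in> simple_roots Rp" "x \<in> B" for e x
  proof (rule closed_sum(2)[OF B(1) simple_R[OF that(1)] _ _ that(2)])
    show "sref e \<circ> x \<in> B" if "x \<in> B" "inv x e \<in> Rp" for x
      using cl that \<open>e \<in> simple_roots Rp\<close> by (simp add: wall_def)
    show "e \<bullet> (\<Sum>x\<in>B. x v) = 0"
      using neg pos simple_Rp[OF that(1)] unfolding f_def inner_commute[of e] by force
  qed
  obtain x where x: "x \<in> B" using B(2) by blast
  obtain ss where ss: "set ss \<subseteq> simple_roots Rp" "x = word_prod ss"
    using weyl_is_word B(1) x by blast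
  have "word_prod ss \<in> B \<Longrightarrow> id \<in> B" using ss(1)
  proof (induction ss)
    case Nil
    then show ?case by simp
  next
    case (Cons a ss)
    have a: "a \<in> simple_roots Rp" and ss: "set ss \<subseteq> simple_roots Rp" using Cons.prems(2) by auto
    have "sref a \<circ> word_prod (a # ss) \<in> B" by (rule cls[OF a Cons.prems(1)])
    then have "word_prod ss \<in> B" unfolding word_prod.simps left_left[OF simple_R[OF a]] .
    then show ?case using Cons.IH ss by blast
  qed
  then show ?thesis using x ss(2) by blast
qed

theorem path_unique:
  assumes "path x gs y" "path x hs y"
  shows "gs = hs"
proof -
  have "uniq x"
  proof (rule ccontr)
    assume "\<not> uniq x"
    then have "{x\<in>weyl R. \<not> uniq x} \<noteq> {}" using path_weyl[OF assms(1)] by blast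
    then have "id \<in> {x\<in>weyl R. \<not> uniq x}"
      by (rule wall_closed_id[rotated]) (use uniq_backward left_weyl wall_R in blast)+
    then show False using uniq_id by blast
  qed
  then show ?thesis using assms unfolding uniq_def by blast
qed

end

section \<open>The chain of affine coroots\<close>


lemma sorted_wrt_exists:
  assumes "finite S"
    and "\<And>a b c. a \<in> S \<Longrightarrow> b \<in> S \<Longrightarrow> c \<in> S \<Longrightarrow> r a b \<Longrightarrow> r b c \<Longrightarrow> r a c"
    and "\<And>a b. a \<in> S \<Longrightarrow> b \<in> S \<Longrightarrow> a \<noteq> b \<Longrightarrow> r a b \<or> r b a"
    and "\<And>a. a \<in> S \<Longrightarrow> \<not> r a a"
  shows "\<exists>L. distinct L \<and> set L = S \<and> sorted_wrt r L"
  using assms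
proof (induction S rule: finite_induct)
  case empty
  then show ?case by simp
next
  case (insert a S)
  have "\<exists>L. distinct L \<and> set L = S \<and> sorted_wrt r L"
    by (rule insert.IH; use insert.prems in blast)
  then obtain L where L: "distinct L" "set L = S" "sorted_wrt r L" by blast
  let ?M = "filter (\<lambda>b. r b a) L @ a # filter (\<lambda>b. r a b) L"
  have tr: "r b c" if "r b a" "r a c" "b \<in> S" "c \<in> S" for b c
    using insert.prems(1)[of b a c] that by blast
  have "\<not> (r b a \<and> r a b)" if "b \<in> S" for b
    using insert.prems(1)[of a b a] insert.prems(3)[of a] that by blast
  then have "distinct ?M" using L insert.hyps by auto
  moreover have "set ?M = insert a S" using L insert.prems(2)[of a] insert.hyps by auto
  moreover have "sorted_wrt r ?M"
    using L tr by (auto simp: sorted_wrt_append sorted_wrt_filter)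
  ultimately show ?case by blast
qed

text \<open>Lets the cut positions of \<open>Xi\<close>, which are counts, be described by
  conditions on chain indices.\<close>

lemma filter_prefix:
  "sorted_wrt (<) js \<Longrightarrow> (\<And>i j. i \<in> set js \<Longrightarrow> j \<in> set js \<Longrightarrow> i < j \<Longrightarrow> P j \<Longrightarrow> P i)
    \<Longrightarrow> js = filter P js @ filter (\<lambda>j. \<not> P j) js" for js :: "'b::linorder list"
proof (induction js)
  case Nil
  then show ?case by simp
next
  case (Cons a js)
  have tl: "js = filter P js @ filter (\<lambda>j. \<not> P j) js"
    by (rule Cons.IH; use Cons.prems in \<open>auto\<close>)
  show ?case
  proof (cases "P a")
    case True
    then show ?thesis using tl by simp
  next
    case False
    then have "\<not> P j" if "j \<in> set js" for j
      using Cons.prems(1) Cons.prems(2)[of a j] that by auto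
    then show ?thesis using False by simp
  qed
qed

lemma take_filter_prefix:
  fixes js :: "'b::linorder list"
  assumes "sorted_wrt (<) js" "\<And>i j. i \<in> set js \<Longrightarrow> j \<in> set js \<Longrightarrow> i < j \<Longrightarrow> P j \<Longrightarrow> P i"
  shows "take (length (filter P js)) js = filter P js"
  by (rule conjunct1[OF append_eq_conv_conj[THEN iffD1, OF filter_prefix[OF assms, symmetric]], symmetric])

lemma nth_filter_prefix:
  fixes js :: "'b::linorder list"
  assumes "sorted_wrt (<) js" "\<And>i j. i \<in> set js \<Longrightarrow> j \<in> set js \<Longrightarrow> i < j \<Longrightarrow> P j \<Longrightarrow> P i"
    and "k < length js"
  shows "P (js ! k) \<longleftrightarrow> k < length (filter P js)"
proof -
  let ?F = "filter P js" and ?G = "filter (\<lambda>j. \<not> P j) js"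
  have eq: "js = ?F @ ?G" using filter_prefix[OF assms(1,2)] .
  have nth: "js ! k = (?F @ ?G) ! k" using arg_cong[OF eq, of "\<lambda>l. l ! k"] .
  have len: "k < length ?F + length ?G"
    using assms(3) arg_cong[OF eq, of length] unfolding length_append by linarith
  show ?thesis
    using nth_mem[of k ?F] nth_mem[of "k - length ?F" ?G] len unfolding nth by (auto simp: nth_append)
qed

lemma card_filter:
  "card {b \<in> {1..length js}. P (js ! (b - 1))} = length (filter P js)"
proof -
  have "{b \<in> {1..length js}. P (js ! (b - 1))} = Suc ` {i. i < length js \<and> P (js ! i)}"
  proof (rule set_eqI)
    fix b
    show "b \<in> {b \<in> {1..length js}. P (js ! (b - 1))} \<longleftrightarrow> b \<in> Suc ` {i. i < length js \<and> P (js ! i)}"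
      by (cases b) auto
  qed
  then show ?thesis by (simp add: card_image length_filter_conv_card)
qed

lemma qbg_path_append:
  "qbg_path R Rp x (as @ bs) z \<Longrightarrow>
    qbg_path R Rp x as (foldl (\<lambda>x a. x \<circ> sref a) x as) \<and> qbg_path R Rp (foldl (\<lambda>x a. x \<circ> sref a) x as) bs z"
proof (induction as arbitrary: x)
  case Nil
  then have "x \<in> weyl R" by (cases bs) (auto simp: qbg_edge_def)
  then show ?case using Nil by simp
next
  case (Cons a as)
  show ?case
    using Cons.IH[of "x \<circ> sref a"] Cons.prems unfolding append_Cons qbg_path.simps foldl.simps by blast
qed

locale lambda_chain = root_sys +
  fixes lam :: 'a and lt :: "'a \<Rightarrow> 'a \<Rightarrow> bool"
  assumes lt_order: "reflection_order Rp lt"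
begin

text \<open>Labels decrease inside a block of the chain, whereas the monotone paths above have
  increasing labels; the reversed relation is again a reflection order.\<close>

sublocale refl_order R Rp v "\<lambda>a b. lt b a"
  by unfold_locales (use lt_order in \<open>unfold reflection_order_def, blast\<close>)

lemma lt_tr: "a \<in> Rp \<Longrightarrow> b \<in> Rp \<Longrightarrow> c \<in> Rp \<Longrightarrow> lt a b \<Longrightarrow> lt b c \<Longrightarrow> lt a c"
  using lt_trans[of c b a] by blast

text \<open>The sign conventions at degree zero, before and after translation, show up in the last
  two facts: the value 0 of \<open>dval\<close> occurs only for positive roots and the value 1 only
  for negative ones. This settles the boundary cuts, where \<open>Xi\<close> gives no middle
  vertex.\<close>

lemma Inv_D:
  assumes "(g, k) \<in> Inv R Rp lam"
  shows "g \<in> R" "pair lam g > 0" "0 \<le> k" "real_of_int k \<le> pair lam g"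
    "k = 0 \<Longrightarrow> g \<in> Rp" "real_of_int k = pair lam g \<Longrightarrow> g \<notin> Rp"
proof -
  have *: "g \<in> R" "k > 0 \<or> (k = 0 \<and> g \<in> Rp)"
    "\<not> (real_of_int k - pair lam g > 0 \<or> (real_of_int k - pair lam g = 0 \<and> g \<in> Rp))"
    using assms by (auto simp: Inv_def)
  show "g \<in> R" "0 \<le> k" "real_of_int k \<le> pair lam g" "k = 0 \<Longrightarrow> g \<in> Rp"
    "real_of_int k = pair lam g \<Longrightarrow> g \<notin> Rp" using * by auto
  show "pair lam g > 0"
  proof (cases "k = 0")
    case True
    then show ?thesis using * by (cases "pair lam g = 0") auto
  next
    case False
    then have "real_of_int k > 0" using *(2) by auto
    then show ?thesis using *(3) by linarith
  qed
qed

lemma prec_iff: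
  assumes "g \<in> R" "pair lam g > 0" "h \<in> R" "pair lam h > 0"
  shows "prec Rp lam lt g h \<longleftrightarrow>
    (if g \<in> Rp then h \<in> Rp \<longrightarrow> lt g h else h \<notin> Rp \<and> lt (- g) (- h))"
proof -
  have "c \<in> pos_part Rp lam \<longleftrightarrow> c \<in> Rp" "c \<in> uminus ` neg_part Rp lam \<longleftrightarrow> c \<notin> Rp"
    if "c \<in> R" "pair lam c > 0" for c
  proof -
    show "c \<in> pos_part Rp lam \<longleftrightarrow> c \<in> Rp" using that by (simp add: pos_part_def)
    have "c \<in> uminus ` neg_part Rp lam \<longleftrightarrow> - c \<in> neg_part Rp lam" by force
    then show "c \<in> uminus ` neg_part Rp lam \<longleftrightarrow> c \<notin> Rp"
      using that neg_Rp[OF that(1)] by (simp add: neg_part_def pair_minus_right)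
  qed
  then show ?thesis using assms unfolding prec_def by auto
qed

lemma finite_Inv: "finite (Inv R Rp lam)"
proof (rule finite_subset)
  show "Inv R Rp lam \<subseteq> (SIGMA g:R. {0..\<lfloor>pair lam g\<rfloor>})"
    using Inv_D by (auto simp: le_floor_iff)
  show "finite (SIGMA g:R. {0..\<lfloor>pair lam g\<rfloor>})" using finR by simp
qed

lemma inv_less_irrefl: "b \<in> Inv R Rp lam \<Longrightarrow> \<not> inv_less Rp lam lt b b"
  using Inv_D[of "fst b" "snd b"] prec_iff[of "fst b" "fst b"] lt_irrefl neg_Rp[of "fst b"]
  by (auto simp: inv_less_def)

lemma inv_less_trans:
  assumes "a \<in> Inv R Rp lam" "b \<in> Inv R Rp lam" "c \<in> Inv R Rp lam"
    "inv_less Rp lam lt a b" "inv_less Rp lam lt b c"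
  shows "inv_less Rp lam lt a c"
proof -
  obtain ga gb gc ka kb kc where eq: "a = (ga, ka)" "b = (gb, kb)" "c = (gc, kc)"
    by (cases a, cases b, cases c) auto
  note D = Inv_D[OF assms(1)[unfolded eq]] Inv_D[OF assms(2)[unfolded eq]] Inv_D[OF assms(3)[unfolded eq]]
  have "prec Rp lam lt gc ga" if "prec Rp lam lt gc gb" "prec Rp lam lt gb ga"
    using that lt_tr[of gc gb ga] lt_tr[of "- gc" "- gb" "- ga"] D neg_Rp[of ga] neg_Rp[of gb] neg_Rp[of gc]
    by (auto simp: prec_iff split: if_splits)
  then show ?thesis using assms(4,5) unfolding inv_less_def eq by auto
qed

lemma inv_less_total:
  assumes "a \<in> Inv R Rp lam" "b \<in> Inv R Rp lam" "a \<noteq> b"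
  shows "inv_less Rp lam lt a b \<or> inv_less Rp lam lt b a"
proof -
  obtain ga gb ka kb where eq: "a = (ga, ka)" "b = (gb, kb)"
    by (cases a, cases b) auto
  note D = Inv_D[OF assms(1)[unfolded eq]] Inv_D[OF assms(2)[unfolded eq]]
  show ?thesis
  proof (cases "dval lam a = dval lam b")
    case True
    then have "ga \<noteq> gb" using assms(3) D unfolding eq dval_def by auto
    then have "prec Rp lam lt ga gb \<or> prec Rp lam lt gb ga"
      using D lt_total[of ga gb] lt_total[of "- ga" "- gb"] neg_Rp[of ga] neg_Rp[of gb]
      by (auto simp: prec_iff split: if_splits)
    then show ?thesis using True unfolding inv_less_def eq by auto
  next
    case False
    then show ?thesis unfolding inv_less_def by auto
  qed
qed

abbreviation L :: "('a \<times> int) list" where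
  "L \<equiv> inv_list R Rp lam lt"

lemma L_props: "distinct L \<and> set L = Inv R Rp lam \<and> sorted_wrt (inv_less Rp lam lt) L"
  unfolding inv_list_def
proof (rule theI')
  let ?Q = "\<lambda>L. distinct L \<and> set L = Inv R Rp lam \<and> sorted_wrt (inv_less Rp lam lt) L"
  have "\<exists>L. ?Q L"
    by (rule sorted_wrt_exists[OF finite_Inv]; use inv_less_trans inv_less_total inv_less_irrefl in blast)
  moreover have "M = N" if "?Q M" "?Q N" for M N
  proof (rule sorted_wrt_eqI)
    show "\<not> inv_less Rp lam lt b a" if "a \<in> set M" "b \<in> set M" "inv_less Rp lam lt a b" for a b
      using that \<open>?Q M\<close> inv_less_trans[of a b a] inv_less_irrefl[of a] by blast
  qed (use that in auto)
  ultimately show "\<exists>!L. ?Q L" by blast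
qed

abbreviation g :: "nat \<Rightarrow> 'a" where "g \<equiv> gam R Rp lam lt"
abbreviation d :: "nat \<Rightarrow> real" where "d \<equiv> dd R Rp lam lt"
abbreviation lab :: "nat \<Rightarrow> 'a" where "lab j \<equiv> absr Rp (g j)"
abbreviation I :: "nat set" where "I \<equiv> {1..length L}"

lemma index_Inv:
  assumes "j \<in> I"
  shows "L ! (j - 1) \<in> Inv R Rp lam"
proof -
  have "L ! (j - 1) \<in> set L" by (rule nth_mem) (use assms in \<open>simp, linarith\<close>)
  then show ?thesis using L_props by blast
qed

lemma index_D:
  assumes "j \<in> I"
  shows "g j \<in> R" "pair lam (g j) > 0" "0 \<le> d j" "d j \<le> 1" "d j = 0 \<Longrightarrow> g j \<in> Rp" "d j = 1 \<Longrightarrow> g j \<notin> Rp"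
proof -
  obtain h k where hk: "L ! (j - 1) = (h, k)" by (cases "L ! (j - 1)")
  note D = Inv_D[OF index_Inv[OF assms, unfolded hk]]
  show "g j \<in> R" "pair lam (g j) > 0" "0 \<le> d j" "d j \<le> 1" "d j = 0 \<Longrightarrow> g j \<in> Rp" "d j = 1 \<Longrightarrow> g j \<notin> Rp"
    using D unfolding gam_def dd_def hk by (auto simp: dval_def)
qed

lemma lab_Rp: "j \<in> I \<Longrightarrow> lab j \<in> Rp"
  using index_D(1)[of j] neg_Rp[of "g j"] by (auto simp: absr_def)

text \<open>Ties in \<open>d\<close> are broken by \<open>prec\<close> with its arguments exchanged,
  hence the reversed order of the labels.\<close>

lemma index_less:
  assumes "i \<in> I" "j \<in> I" "i < j"
  shows "d i \<le> d j"
    and "d i = d j \<Longrightarrow> g i \<in> Rp \<Longrightarrow> g j \<in> Rp"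
    and "d i = d j \<Longrightarrow> (g i \<in> Rp \<longleftrightarrow> g j \<in> Rp) \<Longrightarrow> lt (lab j) (lab i)"
proof -
  have "inv_less Rp lam lt (L ! (i - 1)) (L ! (j - 1))"
  proof (rule sorted_wrt_nth_less[OF conjunct2[OF conjunct2[OF L_props]]])
    have "1 \<le> i" "j \<le> length L" using assms by simp_all
    then show "i - 1 < j - 1" "j - 1 < length L" using assms(3) by linarith+
  qed
  then have *: "d i < d j \<or> (d i = d j \<and> prec Rp lam lt (g j) (g i))"
    by (simp add: inv_less_def dd_def gam_def)
  note D = index_D(1,2)[OF assms(1)] index_D(1,2)[OF assms(2)]
  show "d i \<le> d j" using * by auto
  show "d i = d j \<Longrightarrow> g i \<in> Rp \<Longrightarrow> g j \<in> Rp" using * D by (auto simp: prec_iff split: if_splits)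
  show "d i = d j \<Longrightarrow> (g i \<in> Rp \<longleftrightarrow> g j \<in> Rp) \<Longrightarrow> lt (lab j) (lab i)"
    using * D by (auto simp: prec_iff absr_def split: if_splits)
qed

abbreviation js :: "nat set \<Rightarrow> nat list" where "js A \<equiv> sorted_list_of_set A"

section \<open>Segments of constant value and sign\<close>

text \<open>Vertices are addressed by a predicate on chain indices, because two admissible sets may
  have different numbers of elements before the same cut.\<close>

definition vertex_at :: "('a \<Rightarrow> 'a) \<Rightarrow> nat set \<Rightarrow> (nat \<Rightarrow> bool) \<Rightarrow> ('a \<Rightarrow> 'a)" where
  "vertex_at w A P = foldl (\<lambda>x j. x \<circ> sref (lab j)) w (filter P (js A))"

definition down :: "(nat \<Rightarrow> bool) \<Rightarrow> bool" where
  "down P \<longleftrightarrow> (\<forall>i\<in>I. \<forall>j\<in>I. i < j \<longrightarrow> P j \<longrightarrow> P i)"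

lemma foldl_map_lab: "foldl (\<lambda>x a. x \<circ> sref a) w (map lab ks) = foldl (\<lambda>x j. x \<circ> sref (lab j)) w ks"
  by (simp add: foldl_map)

lemma admissible_fin: "A \<in> admissible R Rp lam lt w \<Longrightarrow> A \<subseteq> I \<and> finite A"
  unfolding admissible_def using finite_subset[OF _ finite_atLeastAtMost] by blast

lemma segment_path:
  assumes A: "A \<in> admissible R Rp lam lt w" and PQ: "down P" "down Q" "\<And>j. P j \<Longrightarrow> Q j"
    and same: "\<And>i j. i \<in> I \<Longrightarrow> j \<in> I \<Longrightarrow> Q i \<Longrightarrow> Q j \<Longrightarrow> \<not> P i \<Longrightarrow> \<not> P j \<Longrightarrow> d i = d j \<and> (g i \<in> Rp \<longleftrightarrow> g j \<in> Rp)"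
  shows "path (vertex_at w A P) (map lab (filter (\<lambda>j. Q j \<and> \<not> P j) (js A))) (vertex_at w A Q)"
proof -
  have AI: "A \<subseteq> I" "finite A" using admissible_fin[OF A] by auto
  have srt: "sorted_wrt (<) (js A)" using strict_sorted_list_of_set by blast
  have srtF: "sorted_wrt (<) (filter F (js A))" for F using sorted_wrt_filter[OF srt] .
  obtain y where y: "qbg_path R Rp w (map lab (js A)) y" using A unfolding admissible_def by blast
  let ?P = "filter P (js A)" and ?M = "filter (\<lambda>j. Q j \<and> \<not> P j) (js A)" and ?N = "filter (\<lambda>j. \<not> Q j) (js A)"
  have 1: "js A = filter Q (js A) @ ?N"
    by (rule filter_prefix[OF srt]) (use AI PQ(2) in \<open>auto simp: down_def\<close>)
  have "filter Q (js A) = filter P (filter Q (js A)) @ filter (\<lambda>j. \<not> P j) (filter Q (js A))"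
    by (rule filter_prefix[OF srtF]) (use AI PQ(1) in \<open>auto simp: down_def\<close>)
  moreover have "filter P (filter Q (js A)) = ?P" using PQ(3) by (auto simp: intro!: filter_cong)
  moreover have "filter (\<lambda>j. \<not> P j) (filter Q (js A)) = ?M" by (auto intro!: filter_cong)
  ultimately have 2: "filter Q (js A) = ?P @ ?M" by simp
  have "qbg_path R Rp w (map lab ?P @ map lab ?M @ map lab ?N) y"
    using y 1 unfolding 2 by (metis append_assoc map_append)
  from qbg_path_append[OF conjunct2[OF qbg_path_append[OF this]]]
  have "qbg_path R Rp (vertex_at w A P) (map lab ?M) (foldl (\<lambda>x a. x \<circ> sref a) (vertex_at w A P) (map lab ?M))"
    unfolding foldl_map_lab vertex_at_def by blast
  moreover have "foldl (\<lambda>x a. x \<circ> sref a) (vertex_at w A P) (map lab ?M) = vertex_at w A Q"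
    unfolding foldl_map_lab vertex_at_def 2 by simp
  moreover have "sorted_wrt (\<lambda>a b. lt b a) (map lab ?M)"
    unfolding sorted_wrt_map
  proof (rule sorted_wrt_mono_rel[OF _ srtF])
    fix i j assume "i \<in> set ?M" "j \<in> set ?M" "i < j"
    moreover from this have "i \<in> I" "j \<in> I" using AI by auto
    ultimately show "lt (lab j) (lab i)" using index_less(3) same by auto
  qed
  ultimately show ?thesis by simp
qed

text \<open>Uniqueness of monotone paths gives equal lists of labels. On a segment the labels
  decrease strictly along the chain, so a label determines its index.\<close>

lemma segment_eq:
  assumes A: "A \<in> admissible R Rp lam lt w" and B: "B \<in> admissible R Rp lam lt w"
    and PQ: "down P" "down Q" "\<And>j. P j \<Longrightarrow> Q j"
    and same: "\<And>i j. i \<in> I \<Longrightarrow> j \<in> I \<Longrightarrow> Q i \<Longrightarrow> Q j \<Longrightarrow> \<not> P i \<Longrightarrow> \<not> P j \<Longrightarrow> d i = d j \<and> (g i \<in> Rp \<longleftrightarrow> g j \<in> Rp)"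
    and eq: "vertex_at w A P = vertex_at w B P" "vertex_at w A Q = vertex_at w B Q"
    and j: "Q j" "\<not> P j"
  shows "j \<in> A \<longleftrightarrow> j \<in> B"
proof -
  let ?M = "\<lambda>A. filter (\<lambda>j. Q j \<and> \<not> P j) (js A)"
  note fin = admissible_fin[OF A] admissible_fin[OF B]
  have "map lab (?M A) = map lab (?M B)"
    using path_unique[OF segment_path[OF A PQ same] segment_path[OF B PQ same, folded eq]] by blast
  moreover have "inj_on lab (set (?M A) \<union> set (?M B))"
  proof (rule linorder_inj_onI)
    fix i k assume ik: "i < k" "i \<in> set (?M A) \<union> set (?M B)" "k \<in> set (?M A) \<union> set (?M B)"
    then have I: "i \<in> I" "k \<in> I" and ik': "Q i" "Q k" "\<not> P i" "\<not> P k" using fin by auto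
    then have "lt (lab k) (lab i)" using index_less(3)[OF I ik(1)] same[OF I ik'] by blast
    then show "lab i \<noteq> lab k" using lt_irrefl[OF lab_Rp[OF I(1)]] by auto
  qed auto
  ultimately have "?M A = ?M B" by (rule map_inj_on)
  then have "j \<in> set (?M A) \<longleftrightarrow> j \<in> set (?M B)" by simp
  then show ?thesis using j fin by simp
qed

section \<open>Cut values and the data recorded by the forgetful map\<close>

definition interior :: "nat set \<Rightarrow> real list" where
  "interior A = sorted_list_of_set (d ` A \<inter> {0<..<1})"

definition cut :: "nat set \<Rightarrow> nat \<Rightarrow> real" where
  "cut A a = (if a = 0 then 0 else if a = length (interior A) + 1 then 1 else interior A ! (a - 1))"

text \<open>Among indices with equal \<open>d\<close> the chain lists the roots of \<open>- Rp\<close> first, so this is an initial segment.\<close>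

definition upto_neg :: "real \<Rightarrow> nat \<Rightarrow> bool" where
  "upto_neg c j \<longleftrightarrow> d j < c \<or> (d j = c \<and> g j \<notin> Rp)"

lemma down_less: "down (\<lambda>j. d j < c)"
  unfolding down_def using index_less(1) le_less_trans by blast

lemma down_le: "down (\<lambda>j. d j \<le> c)"
  unfolding down_def using index_less(1) order_trans by blast

lemma down_upto_neg: "down (upto_neg c)"
  unfolding down_def upto_neg_def
proof (intro ballI impI)
  fix i j assume ij: "i \<in> I" "j \<in> I" "i < j" "d j < c \<or> (d j = c \<and> g j \<notin> Rp)"
  show "d i < c \<or> (d i = c \<and> g i \<notin> Rp)"
    using index_less(1,2)[OF ij(1-3)] ij(4) by (cases "d i = d j") auto
qed

lemma set_interior: "finite A \<Longrightarrow> set (interior A) = d ` A \<inter> {0<..<1}"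
  by (simp add: interior_def)

lemma cut_mono:
  assumes "finite A" "a < b" "b \<le> length (interior A) + 1"
  shows "cut A a < cut A b"
proof -
  have D: "0 < interior A ! i \<and> interior A ! i < 1" if "i < length (interior A)" for i
    using nth_mem[OF that] set_interior[OF assms(1)] by auto
  have "sorted_wrt (<) (interior A)" unfolding interior_def by (rule strict_sorted_list_of_set)
  then have nth: "interior A ! (a - 1) < interior A ! (b - 1)" if "a > 0" "b \<le> length (interior A)"
    by (rule sorted_wrt_nth_less) (use assms that in linarith)+
  consider "a = 0" "b = length (interior A) + 1" | "a = 0" "0 < b" "b \<le> length (interior A)"
    | "a > 0" "a \<le> length (interior A)" "b = length (interior A) + 1" | "a > 0" "b \<le> length (interior A)"
    using assms(2,3) by linarith
  then show ?thesis
  proof cases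
    case 1
    then show ?thesis by (simp add: cut_def)
  next
    case 2
    then show ?thesis using D[of "b - 1"] by (auto simp: cut_def)
  next
    case 3
    then show ?thesis using D[of "a - 1"] by (auto simp: cut_def)
  next
    case 4
    then show ?thesis using nth assms(2) by (auto simp: cut_def)
  qed
qed

lemma cut_less_iff:
  assumes "finite A" "a \<le> length (interior A) + 1" "b \<le> length (interior A) + 1"
  shows "cut A a < cut A b \<longleftrightarrow> a < b"
  using cut_mono[OF assms(1), of a b] cut_mono[OF assms(1), of b a] assms(2,3)
  by (cases a b rule: linorder_cases) auto

lemma d_is_cut:
  assumes A: "A \<subseteq> I" "finite A" and j: "j \<in> A"
  obtains a where "a \<le> length (interior A) + 1" "d j = cut A a"
proof -
  have "0 \<le> d j" "d j \<le> 1" using index_D(3,4)[of j] A j by auto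
  then consider "d j = 0" | "d j = 1" | "0 < d j" "d j < 1" by linarith
  then show thesis
  proof cases
    case 1
    then show thesis using that[of 0] by (simp add: cut_def)
  next
    case 2
    then show thesis using that[of "length (interior A) + 1"] by (simp add: cut_def)
  next
    case 3
    then have "d j \<in> set (interior A)" using set_interior[OF A(2)] j by auto
    then obtain i where i: "i < length (interior A)" "interior A ! i = d j" unfolding in_set_conv_nth by blast
    then show thesis using that[of "Suc i"] by (simp add: cut_def)
  qed
qed

text \<open>Every value of \<open>d\<close> on \<open>A\<close> is itself a cut value, so none lies
  strictly between neighbours. Thus the vertex before the next cut is the vertex after the present
  one.\<close>

lemma d_between:
  assumes A: "A \<subseteq> I" "finite A" and j: "j \<in> A"
    and a: "a \<le> length (interior A)"
  shows "d j < cut A (Suc a) \<longleftrightarrow> d j \<le> cut A a"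
proof -
  obtain b where b: "b \<le> length (interior A) + 1" "d j = cut A b" using d_is_cut[OF A j] .
  have "cut A b < cut A (Suc a) \<longleftrightarrow> b < Suc a" "cut A a < cut A b \<longleftrightarrow> a < b"
    using cut_less_iff[OF A(2)] a b(1) by auto
  then show ?thesis unfolding b(2) by auto
qed

lemma vertex_at_cong: "finite A \<Longrightarrow> (\<And>j. j \<in> A \<Longrightarrow> P j \<longleftrightarrow> Q j) \<Longrightarrow> vertex_at w A P = vertex_at w A Q"
  unfolding vertex_at_def by (metis (mono_tags, lifting) filter_cong set_sorted_list_of_set)

lemma uu_prefix:
  assumes "A \<subseteq> I" "finite A" "down P"
  shows "uu R Rp lam lt w A (length (filter P (js A))) = vertex_at w A P"
proof -
  have "take (length (filter P (js A))) (js A) = filter P (js A)"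
    by (rule take_filter_prefix[OF strict_sorted_list_of_set])
      (use assms in \<open>auto simp: down_def\<close>)
  then show ?thesis unfolding uu_def vertex_at_def by (simp only:)
qed

lemma Xi_eq:
  assumes A: "A \<in> admissible R Rp lam lt w" and t: "t = length (interior A) + 1"
  shows "Xi R Rp lam lt w A =
    (map (\<lambda>i. vertex_at w A (\<lambda>j. d j < cut A (t + 1 - i))) [1..<t+1],
     map (\<lambda>i. vertex_at w A (upto_neg (cut A (t - i)))) [1..<t],
     map (\<lambda>i. 1 - cut A (t - i)) [0..<t+1])"
proof -
  have AI: "A \<subseteq> I" "finite A" using admissible_fin[OF A] by auto
  define p where "p = length (js A)"
  define db where "db b = d (js A ! (b - 1))" for b
  define m where "m a = card {b \<in> {1..p}. db b < cut A a}" for a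
  define n where "n a = m a + card {b. m a < b \<and> b \<le> m (Suc a) \<and> g (js A ! (b - 1)) \<in> uminus ` Rp}" for a
  have p_A: "js A ! (b - 1) \<in> A" if "b \<in> {1..p}" for b
  proof -
    have "js A ! (b - 1) \<in> set (js A)" by (rule nth_mem) (use that in \<open>simp add: p_def, linarith\<close>)
    then show ?thesis using AI by simp
  qed
  have "{db b | b. b \<in> {1..p} \<and> 0 < db b \<and> db b < 1} = d ` A \<inter> {0<..<1}"
  proof (intro equalityI subsetI)
    fix x assume "x \<in> d ` A \<inter> {0<..<1}"
    then obtain j where j: "j \<in> A" "x = d j" "0 < x" "x < 1" by auto
    then obtain i where "i < p" "js A ! i = j" unfolding p_def using AI by (metis in_set_conv_nth set_sorted_list_of_set)
    then have "Suc i \<in> {1..p}" "db (Suc i) = x" using j by (auto simp: db_def)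
    then show "x \<in> {db b | b. b \<in> {1..p} \<and> 0 < db b \<and> db b < 1}" using j by blast
  qed (use p_A in \<open>auto simp: db_def\<close>)
  then have cs: "sorted_list_of_set {db b | b. b \<in> {1..p} \<and> 0 < db b \<and> db b < 1} = interior A"
    by (simp add: interior_def)
  have m: "m a = length (filter (\<lambda>j. d j < cut A a) (js A))" for a
    unfolding m_def p_def db_def by (rule card_filter)
  have um: "uu R Rp lam lt w A (m a) = vertex_at w A (\<lambda>j. d j < cut A a)" for a
    unfolding m by (rule uu_prefix[OF AI down_less])
  have neg: "g j \<in> uminus ` Rp \<longleftrightarrow> g j \<notin> Rp" if "j \<in> A" for j
  proof -
    have "g j \<in> uminus ` Rp \<longleftrightarrow> - g j \<in> Rp" by force
    then show ?thesis using neg_Rp[OF index_D(1), of j] that AI by blast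
  qed
  have le_m: "b \<le> m a \<longleftrightarrow> db b < cut A a" if "b \<in> {1..p}" for a b
  proof -
    have "d (js A ! (b - 1)) < cut A a \<longleftrightarrow> b - 1 < m a"
      unfolding m
    proof (rule nth_filter_prefix[OF strict_sorted_list_of_set])
      show "b - 1 < length (js A)" using that by (simp add: p_def) linarith
    qed (use AI down_less[of "cut A a"] in \<open>auto simp: down_def\<close>)
    then show ?thesis using that unfolding db_def by auto
  qed
  have un: "uu R Rp lam lt w A (n a) = vertex_at w A (upto_neg (cut A a))" if a: "1 \<le> a" "a < t" for a
  proof -
    have mp: "m a \<le> p" for a unfolding m p_def by (rule length_filter_le)
    \<comment> \<open>The positions counted from \<open>m a\<close> to \<open>m (Suc a)\<close> are
      exactly those with value \<open>cut A a\<close>, by \<open>d_between\<close>.\<close>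
    have "{b. m a < b \<and> b \<le> m (Suc a) \<and> g (js A ! (b - 1)) \<in> uminus ` Rp}
        = {b \<in> {1..p}. db b = cut A a \<and> g (js A ! (b - 1)) \<notin> Rp}" (is "?L = ?R")
    proof (rule set_eqI)
      fix b
      show "b \<in> ?L \<longleftrightarrow> b \<in> ?R"
      proof (cases "b \<in> {1..p}")
        case True
        then show ?thesis
          using le_m[OF True, of a] le_m[OF True, of "Suc a"] neg[OF p_A[OF True]]
            d_between[OF AI p_A[OF True], of a] a t
          by (auto simp: db_def)
      next
        case False
        then show ?thesis using mp[of "Suc a"] by auto
      qed
    qed
    then have "n a = card {b \<in> {1..p}. db b < cut A a} + card {b \<in> {1..p}. db b = cut A a \<and> g (js A ! (b - 1)) \<notin> Rp}"
      unfolding n_def m_def by simp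
    also have "\<dots> = card ({b \<in> {1..p}. db b < cut A a} \<union> {b \<in> {1..p}. db b = cut A a \<and> g (js A ! (b - 1)) \<notin> Rp})"
      by (rule card_Un_disjoint[symmetric]) auto
    also have "\<dots> = card {b \<in> {1..length (js A)}. upto_neg (cut A a) (js A ! (b - 1))}"
      unfolding upto_neg_def p_def db_def by (rule arg_cong[of _ _ card]) blast
    also have "\<dots> = length (filter (upto_neg (cut A a)) (js A))" by (rule card_filter)
    finally show ?thesis using uu_prefix[OF AI down_upto_neg] by simp
  qed
  have "Xi R Rp lam lt w A =
    (map (\<lambda>i. uu R Rp lam lt w A (m (t + 1 - i))) [1..<t+1],
     map (\<lambda>i. uu R Rp lam lt w A (n (t - i))) [1..<t],
     map (\<lambda>i. 1 - cut A (t - i)) [0..<t+1])"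
    unfolding Xi_def Let_def n_def m_def db_def[symmetric] p_def[symmetric] cs t cut_def[symmetric] ..
  moreover have "map (\<lambda>i. uu R Rp lam lt w A (n (t - i))) [1..<t] = map (\<lambda>i. vertex_at w A (upto_neg (cut A (t - i)))) [1..<t]"
    by (rule map_cong[OF refl], rule un) auto
  ultimately show ?thesis unfolding um by (simp only:)
qed

lemma adm_end_eq:
  assumes "finite A" "\<And>j. j \<in> A \<Longrightarrow> P j"
  shows "adm_end R Rp lam lt w A = vertex_at w A P"
proof -
  have "filter P (js A) = js A" using assms by (simp add: filter_id_conv)
  moreover have "take (card A) (js A) = js A" by simp
  ultimately show ?thesis unfolding adm_end_def uu_def vertex_at_def by (simp only:)
qed

text \<open>At each cut value three vertices are recoverable: before it, after its negative roots,
  and after all of it. They bound two segments on which uniqueness applies. One inclusion suffices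
  by symmetry.\<close>

lemma admissible_subset:
  assumes A: "A \<in> admissible R Rp lam lt w" and B: "B \<in> admissible R Rp lam lt w"
    and Xi: "Xi R Rp lam lt w A = Xi R Rp lam lt w B"
    and en: "adm_end R Rp lam lt w A = adm_end R Rp lam lt w B"
  shows "A \<subseteq> B"
proof
  fix j assume jA: "j \<in> A"
  have AI: "A \<subseteq> I" "finite A" and BI: "B \<subseteq> I" "finite B"
    using admissible_fin[OF A] admissible_fin[OF B] by auto
  define t where "t = length (interior A) + 1"
  note XA = Xi_eq[OF A t_def]
  have ss: "map (\<lambda>i. 1 - cut A (t - i)) [0..<t+1]
      = map (\<lambda>i. 1 - cut B (length (interior B) + 1 - i)) [0..<length (interior B) + 1 + 1]"
    using Xi unfolding XA Xi_eq[OF B refl] by blast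
  have tB: "t = length (interior B) + 1" using arg_cong[OF ss, of length] by simp
  note XB = Xi_eq[OF B tB]
  have cut: "cut A a = cut B a" if "a \<le> t" for a
  proof -
    have "\<forall>i\<in>set [0..<t+1]. 1 - cut A (t - i) = 1 - cut B (t - i)"
      using ss unfolding tB[symmetric] map_eq_conv .
    moreover have "t - a \<in> set [0..<t+1]" by auto
    ultimately have "1 - cut A (t - (t - a)) = 1 - cut B (t - (t - a))" by blast
    then show ?thesis using that by simp
  qed
  \<comment> \<open>The cut \<open>a = 0\<close> has no entry in \<open>Xi\<close>; no value is
    negative, so the vertex there is the common start \<open>w\<close>.\<close>
  have Lt: "vertex_at w A (\<lambda>j. d j < cut A a) = vertex_at w B (\<lambda>j. d j < cut A a)" if "a \<le> t" for a
  proof (cases "a = 0")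
    case True
    have "vertex_at w C (\<lambda>j. d j < 0) = w" if "C \<subseteq> I" "finite C" for C
    proof -
      have "\<not> d j < 0" if "j \<in> C" for j using index_D(3)[of j] that \<open>C \<subseteq> I\<close> by force
      then have "filter (\<lambda>j. d j < 0) (js C) = []" using that by (simp add: filter_empty_conv)
      then show ?thesis unfolding vertex_at_def by simp
    qed
    then show ?thesis using True AI BI by (simp add: cut_def)
  next
    case False
    have "\<forall>i\<in>set [1..<t+1]. vertex_at w A (\<lambda>j. d j < cut A (t + 1 - i)) = vertex_at w B (\<lambda>j. d j < cut B (t + 1 - i))"
      using Xi unfolding XA XB prod.inject map_eq_conv by blast
    moreover have "t + 1 - a \<in> set [1..<t+1]" using False that by auto
    ultimately have "vertex_at w A (\<lambda>j. d j < cut A (t + 1 - (t + 1 - a))) = vertex_at w B (\<lambda>j. d j < cut B (t + 1 - (t + 1 - a)))"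
      by blast
    then show ?thesis using that cut[OF that] by simp
  qed
  \<comment> \<open>After the last cut only the end point gives the vertex; this is where
    \<open>adm_end\<close> enters.\<close>
  have Le: "vertex_at w A (\<lambda>j. d j \<le> cut A a) = vertex_at w B (\<lambda>j. d j \<le> cut A a)" if "a \<le> t" for a
  proof (cases "a = t")
    case True
    have le: "d i \<le> cut A a" if "i \<in> I" for i using True index_D(4)[OF that] by (simp add: cut_def t_def)
    have "adm_end R Rp lam lt w A = vertex_at w A (\<lambda>j. d j \<le> cut A a)"
      by (rule adm_end_eq[OF AI(2)]) (use le AI(1) in blast)
    moreover have "adm_end R Rp lam lt w B = vertex_at w B (\<lambda>j. d j \<le> cut A a)"
      by (rule adm_end_eq[OF BI(2)]) (use le BI(1) in blast)
    ultimately show ?thesis using en by simp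
  next
    case False
    then have a: "Suc a \<le> t" "a \<le> length (interior A)" "a \<le> length (interior B)" using that t_def tB by auto
    have "vertex_at w A (\<lambda>j. d j \<le> cut A a) = vertex_at w A (\<lambda>j. d j < cut A (Suc a))"
      by (rule vertex_at_cong[OF AI(2)]) (simp add: d_between[OF AI _ a(2)])
    moreover have "vertex_at w B (\<lambda>j. d j \<le> cut A a) = vertex_at w B (\<lambda>j. d j < cut A (Suc a))"
      unfolding cut[OF that] cut[OF a(1)] by (rule vertex_at_cong[OF BI(2)]) (simp add: d_between[OF BI _ a(3)])
    ultimately show ?thesis using Lt[OF a(1)] by simp
  qed
  \<comment> \<open>At the cut 0 there are no negative roots and at the cut 1 no positive ones, so
    there the middle vertex coincides with the one before or after the cut.\<close>
  have Mid: "vertex_at w A (upto_neg (cut A a)) = vertex_at w B (upto_neg (cut A a))" if at: "a \<le> t" for a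
  proof -
    consider "a = 0" | "a = t" | "1 \<le> a" "a < t" using at by linarith
    then show ?thesis
    proof cases
      case 1
      have "vertex_at w C (upto_neg 0) = vertex_at w C (\<lambda>j. d j < 0)" if "C \<subseteq> I" "finite C" for C
        by (rule vertex_at_cong[OF that(2)]) (use index_D(5) that(1) in \<open>auto simp: upto_neg_def\<close>)
      then show ?thesis using Lt[of 0] AI BI 1 by (simp add: cut_def)
    next
      case 2
      then have c: "cut A a = 1" by (simp add: cut_def t_def)
      have "vertex_at w C (upto_neg 1) = vertex_at w C (\<lambda>j. d j \<le> 1)" if "C \<subseteq> I" "finite C" for C
        by (rule vertex_at_cong[OF that(2)]) (use index_D(6) that(1) in \<open>auto simp: upto_neg_def\<close>)
      then show ?thesis using Le[OF at] AI BI unfolding c by simp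
    next
      case 3
      have "\<forall>i\<in>set [1..<t]. vertex_at w A (upto_neg (cut A (t - i))) = vertex_at w B (upto_neg (cut B (t - i)))"
        using Xi unfolding XA XB prod.inject map_eq_conv by blast
      moreover have "t - a \<in> set [1..<t]" using 3 by auto
      ultimately have "vertex_at w A (upto_neg (cut A (t - (t - a)))) = vertex_at w B (upto_neg (cut B (t - (t - a))))" by blast
      then show ?thesis using at cut[OF at] by simp
    qed
  qed
  obtain a where a: "a \<le> t" "d j = cut A a" using d_is_cut[OF AI jA] unfolding t_def by blast
  let ?c = "cut A a"
  show "j \<in> B"
  proof (cases "g j \<in> Rp")
    case False
    have "j \<in> A \<longleftrightarrow> j \<in> B"
      by (rule segment_eq[OF A B down_less down_upto_neg _ _ Lt[OF a(1)] Mid[OF a(1)]])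
        (use False a in \<open>auto simp: upto_neg_def\<close>)
    then show ?thesis using jA by blast
  next
    case True
    have "j \<in> A \<longleftrightarrow> j \<in> B"
      by (rule segment_eq[OF A B down_upto_neg down_le _ _ Mid[OF a(1)] Le[OF a(1)]])
        (use True a in \<open>auto simp: upto_neg_def\<close>)
    then show ?thesis using jA by blast
  qed
qed

end

theorem theorem5p7:
  fixes R Rp :: "'a::euclidean_space set" and lam :: 'a
    and lt :: "'a \<Rightarrow> 'a \<Rightarrow> bool" and w :: "'a \<Rightarrow> 'a"
  assumes "root_system R" and "irreducible_rs R" and "positive_system R Rp"
    and "lam \<in> weight_lattice R" and "RO lam Rp lt" and "w \<in> weyl R"
  shows "inj_on (\<lambda>A. (Xi R Rp lam lt w A, adm_end R Rp lam lt w A)) (admissible R Rp lam lt w)"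
proof -
  obtain v where v: "\<forall>a\<in>R. a \<bullet> v \<noteq> 0" "Rp = {a\<in>R. a \<bullet> v > 0}"
    using assms(3) unfolding positive_system_def by blast
  interpret lambda_chain R Rp v lam lt
  proof unfold_locales
    show "root_system R" by (rule assms(1))
    show "a \<bullet> v \<noteq> 0" if "a \<in> R" for a using v(1) that by blast
    show "Rp = {a\<in>R. a \<bullet> v > 0}" by (rule v(2))
    show "reflection_order Rp lt" using assms(5) unfolding RO_def by blast
  qed
  show ?thesis
  proof (rule inj_onI)
    fix A B assume "A \<in> admissible R Rp lam lt w" "B \<in> admissible R Rp lam lt w"
      "(Xi R Rp lam lt w A, adm_end R Rp lam lt w A) = (Xi R Rp lam lt w B, adm_end R Rp lam lt w B)"
    then show "A = B"
      unfolding prod.inject[of "Xi R Rp lam lt w A"]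
      using admissible_subset[of A w B] admissible_subset[of B w A] by (intro equalityI) simp_all
  qed
qed

end
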